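(* Let $D$ be a Dynkin diagram with Weyl group $W(D)$, let $H(D)$ be the free $\mathbb Z$-module with Schubert basis $\{\mathcal S_w : w\in W(D)\}$, let $Nil(D)$ be the (completed) nil Hecke algebra, and let $\partial_\pi$ and $M_\pi$ ($\pi\in W(D)$) be the "partial" and "martial" operators on $H(D)$, all as defined in the context. Then: (1) The map $d_\pi\mapsto M_\pi$, i.e. $\sum_\pi c_\pi d_\pi \mapsto \sum_\pi c_\pi M_\pi$, is well-defined (also for infinite sums) and defines an action of the algebra $Nil(D)$ on $H(D)$. This action commutes with the action of the opposite algebra $Nil(D)^{op}$ on $H(D)$ given by $d_\pi\mapsto\partial_\pi$. (2) Conversely, each operator (i.e. $\mathbb Z$-linear endomorphism) $C$ of $H(D)$ that commutes with all the operators $\partial_\alpha$, $\alpha$ a vertex of $D$, arises as the action of a unique element of $Nil(D)$: there is a unique family of integers $(c_\pi)_{\pi\in W(D)}$ with $C=\sum_{\pi} c_\pi M_\pi$. In short, $Nil(D)$ (acting by $d_\pi\mapsto M_\pi$) and $Nil(D)^{op}$ (acting by $d_\pi\mapsto \partial_\pi$) are one another's commutants in $\mathrm{End}_{\mathbb Z}(H(D))$.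
   Context: $D$ is a Dynkin diagram, possibly with infinitely many vertices (for example $A_{\mathbb Z_+}$ or $A_{\mathbb Z}$, whose Weyl groups are the groups of finite permutations of $\mathbb Z_+$ and of $\mathbb Z$ respectively). Its Weyl group $W(D)$ is the Coxeter group generated by the simple reflections $r_\alpha$, one for each vertex $\alpha$ of $D$; $\ell$ denotes Coxeter length, $<$ denotes Bruhat order (so $\pi r_\alpha<\pi$ iff $\ell(\pi r_\alpha)=\ell(\pi)-1$, and similarly on the left), and $e$ is the identity. $H(D)$ is the cohomology ring of the flag variety associated with $D$. For this statement only its additive structure is needed: it is the free $\mathbb Z$-module of finite $\mathbb Z$-linear combinations of the Schubert symbols $\mathcal S_w$, $w\in W(D)$. $Nil(D)$ is the set of formal, possibly infinite, $\mathbb Z$-linear combinations $\sum_{\pi\in W(D)}c_\pi d_\pi$, with multiplication determined by $d_\pi d_\rho = d_{\pi\rho}$ if $\ell(\pi\rho)=\ell(\pi)+\ell(\rho)$ and $d_\pi d_\rho=0$ if $\ell(\pi\rho)<\ell(\pi)+\ell(\rho)$, extended to infinite sums (this is well-defined because each $w\in W(D)$ has only finitely many length-additive factorizations $w=\pi\rho$). For a vertex $\alpha$ of $D$, the $\mathbb Z$-linear operators $\partial_\alpha$ ("partial $\alpha$") and $M_\alpha$ ("martial $\alpha$") on $H(D)$ are $$\partial_\alpha\mathcal S_\pi=\begin{cases}\mathcal S_{\pi r_\alpha}&\text{if }\pi r_\alpha<\pi\\0&\text{if }\pi r_\alpha>\pi\end{cases}\qquad M_\alpha\mathcal S_\pi=\begin{cases}\mathcal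 S_{r_\alpha\pi}&\text{if }r_\alpha\pi<\pi\\0&\text{if }r_\alpha\pi>\pi.\end{cases}$$ For $\pi\in W(D)$ with a reduced expression $\pi=r_{\alpha_1}r_{\alpha_2}\cdots r_{\alpha_k}$, set $M_\pi:=M_{\alpha_1}\circ M_{\alpha_2}\circ\cdots\circ M_{\alpha_k}$ and $\partial_\pi:=\partial_{\alpha_k}\circ\cdots\circ\partial_{\alpha_1}$; these are independent of the choice of reduced expression. An infinite sum $\sum_\pi c_\pi M_\pi$ (or $\sum_\pi c_\pi\partial_\pi$) makes sense as an operator because only finitely many terms are nonzero on any given element of $H(D)$. The assignment $d_\pi\mapsto\partial_\pi$ gives an action of the opposite algebra $Nil(D)^{op}$ on $H(D)$. *)

theory Defs
  imports "HOL-Algebra.Free_Abelian_Groups" "HOL-Algebra.RingHom"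
begin

section \<open>Dynkin diagrams and their Weyl groups\<close>

text \<open>
  A Dynkin diagram is given by its vertex set, which may be infinite, together with the generalized
  Cartan matrix that its (multiple, oriented) edges encode.
\<close>

record 'v dynkin =
  vertices :: "'v set"
  cartan :: "'v \<Rightarrow> 'v \<Rightarrow> int"

definition dynkin_diagram :: "'v dynkin \<Rightarrow> bool" where
  "dynkin_diagram D \<longleftrightarrow>
    (\<forall>\<alpha>\<in>vertices D. cartan D \<alpha> \<alpha> = 2) \<and>
    (\<forall>\<alpha>\<in>vertices D. \<forall>\<beta>\<in>vertices D. \<alpha> \<noteq> \<beta> \<longrightarrow>
      cartan D \<alpha> \<beta> \<le> 0 \<and> (cartan D \<alpha> \<beta> = 0 \<longleftrightarrow> cartan D \<beta> \<alpha> = 0))"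

text \<open>The value \<open>0\<close> of the Coxeter matrix stands for \<open>\<infinity>\<close>, that is, for no relation.\<close>

definition coxeter_matrix :: "'v dynkin \<Rightarrow> 'v \<Rightarrow> 'v \<Rightarrow> nat" where
  "coxeter_matrix D \<alpha> \<beta> =
    (if \<alpha> = \<beta> then 1
     else let p = cartan D \<alpha> \<beta> * cartan D \<beta> \<alpha> in
       if p = 0 then 2 else if p = 1 then 3 else if p = 2 then 4 else if p = 3 then 6 else 0)"

text \<open>
  The Coxeter group is presented by the generators \<open>r\<^sub>\<alpha>\<close> and the relations
  \<open>(r\<^sub>\<alpha> r\<^sub>\<beta>)\<^bsup>m(\<alpha>,\<beta>)\<^esup> = e\<close>.  As \<open>m(\<alpha>,\<alpha>) = 1\<close> makes the generators involutions, words without formal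
  inverses suffice.  For \<open>m(\<alpha>,\<beta>) = \<infinity>\<close>, encoded as \<open>0\<close>, the rule \<open>relator\<close> is reflexivity.
\<close>

inductive_set coxeter_rel :: "'v dynkin \<Rightarrow> ('v list \<times> 'v list) set" for D where
  refl: "us \<in> lists (vertices D) \<Longrightarrow> (us, us) \<in> coxeter_rel D"
| sym: "(us, vs) \<in> coxeter_rel D \<Longrightarrow> (vs, us) \<in> coxeter_rel D"
| trans: "(us, vs) \<in> coxeter_rel D \<Longrightarrow> (vs, ws) \<in> coxeter_rel D \<Longrightarrow> (us, ws) \<in> coxeter_rel D"
| relator: "us \<in> lists (vertices D) \<Longrightarrow> vs \<in> lists (vertices D) \<Longrightarrow>
    \<alpha> \<in> vertices D \<Longrightarrow> \<beta> \<in> vertices D \<Longrightarrow>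
    (us @ concat (replicate (coxeter_matrix D \<alpha> \<beta>) [\<alpha>, \<beta>]) @ vs, us @ vs) \<in> coxeter_rel D"

definition weyl_group :: "'v dynkin \<Rightarrow> 'v list set monoid" where
  "weyl_group D =
    \<lparr>carrier = lists (vertices D) // coxeter_rel D,
     monoid.mult = (\<lambda>X Y. \<Union>us\<in>X. \<Union>vs\<in>Y. coxeter_rel D `` {us @ vs}),
     one = coxeter_rel D `` {[]}\<rparr>"

definition simple_reflection :: "'v dynkin \<Rightarrow> 'v \<Rightarrow> 'v list set" where
  "simple_reflection D \<alpha> = coxeter_rel D `` {[\<alpha>]}"

definition word_prod :: "'v dynkin \<Rightarrow> 'v list \<Rightarrow> 'v list set" where
  "word_prod D as =
    foldr (\<lambda>\<alpha> w. simple_reflection D \<alpha> \<otimes>\<^bsub>weyl_group D\<^esub> w) as \<one>\<^bsub>weyl_group D\<^esub>"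

definition coxeter_length :: "'v dynkin \<Rightarrow> 'v list set \<Rightarrow> nat" where
  "coxeter_length D w = (LEAST k. \<exists>as\<in>lists (vertices D). length as = k \<and> word_prod D as = w)"

definition reduced_word :: "'v dynkin \<Rightarrow> 'v list \<Rightarrow> 'v list set \<Rightarrow> bool" where
  "reduced_word D as w \<longleftrightarrow>
    as \<in> lists (vertices D) \<and> word_prod D as = w \<and> length as = coxeter_length D w"

definition reflections :: "'v dynkin \<Rightarrow> 'v list set set" where
  "reflections D =
    {x \<otimes>\<^bsub>weyl_group D\<^esub> simple_reflection D \<alpha> \<otimes>\<^bsub>weyl_group D\<^esub> inv\<^bsub>weyl_group D\<^esub> x | x \<alpha>.
      x \<in> carrier (weyl_group D) \<and> \<alpha> \<in> vertices D}"

text \<open>The strict Bruhat order.\<close>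

definition bruhat_less :: "'v dynkin \<Rightarrow> 'v list set \<Rightarrow> 'v list set \<Rightarrow> bool" where
  "bruhat_less D u w \<longleftrightarrow>
    (u, w) \<in> {(x, x \<otimes>\<^bsub>weyl_group D\<^esub> t) | x t. x \<in> carrier (weyl_group D) \<and> t \<in> reflections D \<and>
      coxeter_length D x < coxeter_length D (x \<otimes>\<^bsub>weyl_group D\<^esub> t)}\<^sup>+"


section \<open>Rings of endomorphisms, opposite rings, commutants\<close>

text \<open>
  Endomorphisms are taken to be \<open>undefined\<close> outside the carrier, so that equality in this
  ring is equality of operators on the group.
\<close>

definition End_ring :: "'a monoid \<Rightarrow> ('a \<Rightarrow> 'a) ring" where
  "End_ring G =
    \<lparr>carrier = hom G G \<inter> extensional (carrier G),
     monoid.mult = (\<lambda>f g. compose (carrier G) f g),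
     one = (\<lambda>x\<in>carrier G. x),
     zero = (\<lambda>x\<in>carrier G. \<one>\<^bsub>G\<^esub>),
     add = (\<lambda>f g. \<lambda>x\<in>carrier G. f x \<otimes>\<^bsub>G\<^esub> g x)\<rparr>"

definition opposite_ring :: "'a ring \<Rightarrow> 'a ring" where
  "opposite_ring R = R\<lparr>monoid.mult := (\<lambda>x y. y \<otimes>\<^bsub>R\<^esub> x)\<rparr>"

definition commutant :: "'a ring \<Rightarrow> 'a set \<Rightarrow> 'a set" where
  "commutant R S = {x \<in> carrier R. \<forall>y\<in>S. x \<otimes>\<^bsub>R\<^esub> y = y \<otimes>\<^bsub>R\<^esub> x}"


section \<open>The nil Hecke algebra\<close>

definition additive_factorizations ::
    "'v dynkin \<Rightarrow> 'v list set \<Rightarrow> ('v list set \<times> 'v list set) set" where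
  "additive_factorizations D w =
    {(\<pi>, \<rho>). \<pi> \<in> carrier (weyl_group D) \<and> \<rho> \<in> carrier (weyl_group D) \<and>
      \<pi> \<otimes>\<^bsub>weyl_group D\<^esub> \<rho> = w \<and> coxeter_length D w = coxeter_length D \<pi> + coxeter_length D \<rho>}"

text \<open>
  The formal sum \<open>\<Sum>\<^sub>\<pi> c\<^sub>\<pi> d\<^sub>\<pi>\<close> is the family \<open>c\<close> of its coefficients.  The product collects, for each
  \<open>w\<close>, the terms \<open>a\<^sub>\<pi> b\<^sub>\<rho> d\<^sub>\<pi> d\<^sub>\<rho>\<close> with \<open>d\<^sub>\<pi> d\<^sub>\<rho> = d\<^sub>w\<close>.
\<close>

definition Nil_algebra :: "'v dynkin \<Rightarrow> ('v list set \<Rightarrow> int) ring" where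
  "Nil_algebra D =
    \<lparr>carrier = carrier (weyl_group D) \<rightarrow>\<^sub>E UNIV,
     monoid.mult = (\<lambda>a b. \<lambda>w\<in>carrier (weyl_group D).
       \<Sum>(\<pi>, \<rho>)\<in>additive_factorizations D w. a \<pi> * b \<rho>),
     one = (\<lambda>w\<in>carrier (weyl_group D). if w = \<one>\<^bsub>weyl_group D\<^esub> then 1 else 0),
     zero = (\<lambda>w\<in>carrier (weyl_group D). 0),
     add = (\<lambda>a b. \<lambda>w\<in>carrier (weyl_group D). a w + b w)\<rparr>"


section \<open>Schubert classes and the operators on them\<close>

text \<open>The Schubert symbol \<open>\<S>\<^sub>w\<close> is \<^term>\<open>frag_of w\<close>.\<close>

definition H :: "'v dynkin \<Rightarrow> ('v list set \<Rightarrow>\<^sub>0 int) monoid" where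
  "H D = free_Abelian_group (carrier (weyl_group D))"

definition partial_op ::
    "'v dynkin \<Rightarrow> 'v \<Rightarrow> ('v list set \<Rightarrow>\<^sub>0 int) \<Rightarrow> ('v list set \<Rightarrow>\<^sub>0 int)" where
  "partial_op D \<alpha> = (\<lambda>x\<in>carrier (H D). frag_extend
    (\<lambda>\<pi>. if bruhat_less D (\<pi> \<otimes>\<^bsub>weyl_group D\<^esub> simple_reflection D \<alpha>) \<pi>
         then frag_of (\<pi> \<otimes>\<^bsub>weyl_group D\<^esub> simple_reflection D \<alpha>) else 0) x)"

definition martial_op ::
    "'v dynkin \<Rightarrow> 'v \<Rightarrow> ('v list set \<Rightarrow>\<^sub>0 int) \<Rightarrow> ('v list set \<Rightarrow>\<^sub>0 int)" where
  "martial_op D \<alpha> = (\<lambda>x\<in>carrier (H D). frag_extend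
    (\<lambda>\<pi>. if bruhat_less D (simple_reflection D \<alpha> \<otimes>\<^bsub>weyl_group D\<^esub> \<pi>) \<pi>
         then frag_of (simple_reflection D \<alpha> \<otimes>\<^bsub>weyl_group D\<^esub> \<pi>) else 0) x)"

text \<open>
  On a word \<open>\<alpha>\<^sub>1 \<dots> \<alpha>\<^sub>k\<close> these are \<open>M\<^bsub>\<alpha>\<^sub>1\<^esub> \<circ> \<dots> \<circ> M\<^bsub>\<alpha>\<^sub>k\<^esub>\<close> and \<open>\<partial>\<^bsub>\<alpha>\<^sub>k\<^esub> \<circ> \<dots> \<circ> \<partial>\<^bsub>\<alpha>\<^sub>1\<^esub>\<close>; note the reversal in the
  second.
\<close>

definition martial_word ::
    "'v dynkin \<Rightarrow> 'v list \<Rightarrow> ('v list set \<Rightarrow>\<^sub>0 int) \<Rightarrow> ('v list set \<Rightarrow>\<^sub>0 int)" where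
  "martial_word D as =
    foldr (\<lambda>\<alpha> f. martial_op D \<alpha> \<otimes>\<^bsub>End_ring (H D)\<^esub> f) as \<one>\<^bsub>End_ring (H D)\<^esub>"

definition partial_word ::
    "'v dynkin \<Rightarrow> 'v list \<Rightarrow> ('v list set \<Rightarrow>\<^sub>0 int) \<Rightarrow> ('v list set \<Rightarrow>\<^sub>0 int)" where
  "partial_word D as =
    foldr (\<lambda>\<alpha> f. f \<otimes>\<^bsub>End_ring (H D)\<^esub> partial_op D \<alpha>) as \<one>\<^bsub>End_ring (H D)\<^esub>"

definition martial ::
    "'v dynkin \<Rightarrow> 'v list set \<Rightarrow> ('v list set \<Rightarrow>\<^sub>0 int) \<Rightarrow> ('v list set \<Rightarrow>\<^sub>0 int)" where
  "martial D \<pi> = martial_word D (SOME as. reduced_word D as \<pi>)"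

definition partial ::
    "'v dynkin \<Rightarrow> 'v list set \<Rightarrow> ('v list set \<Rightarrow>\<^sub>0 int) \<Rightarrow> ('v list set \<Rightarrow>\<^sub>0 int)" where
  "partial D \<pi> = partial_word D (SOME as. reduced_word D as \<pi>)"

text \<open>The operators \<open>\<Sum>\<^sub>\<pi> c\<^sub>\<pi> M\<^sub>\<pi>\<close> and \<open>\<Sum>\<^sub>\<pi> c\<^sub>\<pi> \<partial>\<^sub>\<pi>\<close>, evaluated pointwise on the nonzero terms.\<close>

definition martial_action ::
    "'v dynkin \<Rightarrow> ('v list set \<Rightarrow> int) \<Rightarrow> ('v list set \<Rightarrow>\<^sub>0 int) \<Rightarrow> ('v list set \<Rightarrow>\<^sub>0 int)" where
  "martial_action D c = (\<lambda>x\<in>carrier (H D).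
    \<Sum>\<pi> | \<pi> \<in> carrier (weyl_group D) \<and> martial D \<pi> x \<noteq> 0. frag_cmul (c \<pi>) (martial D \<pi> x))"

definition partial_action ::
    "'v dynkin \<Rightarrow> ('v list set \<Rightarrow> int) \<Rightarrow> ('v list set \<Rightarrow>\<^sub>0 int) \<Rightarrow> ('v list set \<Rightarrow>\<^sub>0 int)" where
  "partial_action D c = (\<lambda>x\<in>carrier (H D).
    \<Sum>\<pi> | \<pi> \<in> carrier (weyl_group D) \<and> partial D \<pi> x \<noteq> 0. frag_cmul (c \<pi>) (partial D \<pi> x))"

end

theory Submission
  imports Defs
begin

text \<open>
  Since a simple reflection changes the length by exactly one, a composite of martial operators along
  any reduced word of \<open>\<pi>\<close> sends \<open>\<S>\<^sub>w\<close> to \<open>\<S>\<^bsub>\<pi>w\<^esub>\<close> if \<open>\<ell>(\<pi>w) = \<ell>(w) - \<ell>(\<pi>)\<close> and to \<open>0\<close> otherwise, so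
  that no braid relations are needed.  The partial operators are the same operators for the opposite
  group, which exchanges the two halves of the statement.  The only further property of Coxeter
  groups that enters is the finiteness of the set of length-additive factorizations of an element;
  it follows from the finiteness of the set of left descents.

  If \<open>C\<close> commutes with all \<open>\<partial>\<^sub>\<rho>\<close>, then the coefficient of \<open>\<S>\<^sub>v\<close> in \<open>C \<S>\<^sub>w\<close> is that of \<open>\<S>\<^sub>e\<close> in
  \<open>\<partial>\<^bsub>v\<inverse>\<^esub> C \<S>\<^sub>w = C \<partial>\<^bsub>v\<inverse>\<^esub> \<S>\<^sub>w\<close>, so \<open>C\<close> is the action of the family \<open>c\<^sub>\<pi>\<close> given by the coefficient of \<open>\<S>\<^sub>e\<close>
  in \<open>C \<S>\<^bsub>\<pi>\<inverse>\<^esub>\<close>.  This also gives multiplicativity: \<open>M\<^sub>a M\<^sub>b\<close> commutes with all \<open>\<partial>\<^sub>\<rho>\<close>, so only its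
  coefficients at \<open>\<S>\<^sub>e\<close> have to be computed.  The ring axioms of \<open>Nil(D)\<close> are pulled back along the
  injective action.
\<close>


section \<open>Rings and opposite groups\<close>

text \<open>Each equational axiom is carried by \<open>h\<close> into \<open>S\<close> and brought
  back by injectivity; only closure and additive inverses have to be supplied in \<open>R\<close>
  itself. This spares a direct proof that the convolution product of \<open>nil_ring\<close> is
  associative.\<close>

lemma ring_pullback:
  fixes R (structure) and S (structure)
  assumes S: "ring S" and inj: "inj_on h (carrier R)"
    and closed: "\<And>x. x \<in> carrier R \<Longrightarrow> h x \<in> carrier S"
    and R_closed: "\<And>x y. x \<in> carrier R \<Longrightarrow> y \<in> carrier R \<Longrightarrow> x \<otimes> y \<in> carrier R"
      "\<And>x y. x \<in> carrier R \<Longrightarrow> y \<in> carrier R \<Longrightarrow> x \<oplus> y \<in> carrier R"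
      "\<one> \<in> carrier R" "\<zero> \<in> carrier R"
      "\<And>x. x \<in> carrier R \<Longrightarrow> \<exists>y\<in>carrier R. y \<oplus> x = \<zero>"
    and hom: "\<And>x y. x \<in> carrier R \<Longrightarrow> y \<in> carrier R \<Longrightarrow> h (x \<otimes> y) = h x \<otimes>\<^bsub>S\<^esub> h y"
      "\<And>x y. x \<in> carrier R \<Longrightarrow> y \<in> carrier R \<Longrightarrow> h (x \<oplus> y) = h x \<oplus>\<^bsub>S\<^esub> h y"
      "h \<one> = \<one>\<^bsub>S\<^esub>" "h \<zero> = \<zero>\<^bsub>S\<^esub>"
  shows "ring R"
proof -
  interpret S: ring S by (rule S)
  note eqI = inj_onD[OF inj]
  show ?thesis
  proof (intro ringI abelian_groupI monoidI)
    fix x y z assume xyz: "x \<in> carrier R" "y \<in> carrier R" "z \<in> carrier R"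
    note [simp] = xyz R_closed closed hom
    show "(x \<oplus> y) \<oplus> z = x \<oplus> (y \<oplus> z)" by (rule eqI) (simp_all add: S.a_assoc)
    show "(x \<otimes> y) \<otimes> z = x \<otimes> (y \<otimes> z)" by (rule eqI) (simp_all add: S.m_assoc)
    show "(x \<oplus> y) \<otimes> z = x \<otimes> z \<oplus> y \<otimes> z" by (rule eqI) (simp_all add: S.l_distr)
    show "z \<otimes> (x \<oplus> y) = z \<otimes> x \<oplus> z \<otimes> y" by (rule eqI) (simp_all add: S.r_distr)
  next
    fix x y assume xy: "x \<in> carrier R" "y \<in> carrier R"
    note [simp] = xy R_closed closed hom
    show "x \<oplus> y = y \<oplus> x" by (rule eqI) (simp_all add: S.a_comm)
  next
    fix x assume x: "x \<in> carrier R"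
    note [simp] = x R_closed closed hom
    show "\<zero> \<oplus> x = x" "\<one> \<otimes> x = x" "x \<otimes> \<one> = x" by (rule eqI; simp)+
  qed (use R_closed in auto)
qed

text \<open>Commutativity of \<open>G\<close> makes pointwise products and pointwise inverses of
  homomorphisms homomorphisms again.\<close>

lemma ring_End_ring:
  fixes G (structure)
  assumes "comm_group G"
  shows "ring (End_ring G)"
proof -
  interpret comm_group G by (rule assms)
  have hom_mult: "f (x \<otimes> y) = f x \<otimes> f y" "f x \<in> carrier G"
    if "f \<in> hom G G" "x \<in> carrier G" "y \<in> carrier G" for f x y
    using that by (auto simp: hom_def)
  have hom_one: "f \<one> = \<one>" if "f \<in> hom G G" for f
    using that by (metis group_hom.hom_one group_hom.intro group_hom_axioms.intro is_group)
  have EndD: "f \<in> hom G G" "f \<in> extensional (carrier G)" if "f \<in> carrier (End_ring G)" for f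
    using that by (auto simp: End_ring_def)
  have homD: "f x \<in> carrier G" "f (x \<otimes> y) = f x \<otimes> f y" "f \<one> = \<one>"
    if "f \<in> carrier (End_ring G)" "x \<in> carrier G" "y \<in> carrier G" for f x y
    using that hom_mult hom_one by (auto dest: EndD)
  have EndI: "restrict f (carrier G) \<in> carrier (End_ring G)"
    if "\<And>x. x \<in> carrier G \<Longrightarrow> f x \<in> carrier G"
      "\<And>x y. x \<in> carrier G \<Longrightarrow> y \<in> carrier G \<Longrightarrow> f (x \<otimes> y) = f x \<otimes> f y" for f
    using that by (auto simp: End_ring_def intro!: homI)
  have ops: "f \<otimes>\<^bsub>End_ring G\<^esub> g = (\<lambda>x\<in>carrier G. f (g x))"
    "f \<oplus>\<^bsub>End_ring G\<^esub> g = (\<lambda>x\<in>carrier G. f x \<otimes> g x)"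
    "\<one>\<^bsub>End_ring G\<^esub> = (\<lambda>x\<in>carrier G. x)" "\<zero>\<^bsub>End_ring G\<^esub> = (\<lambda>x\<in>carrier G. \<one>)" for f g
    by (simp_all add: End_ring_def compose_def)
  have eqI: "f = g" if "f \<in> extensional (carrier G)" "g \<in> extensional (carrier G)"
    "\<And>x. x \<in> carrier G \<Longrightarrow> f x = g x" for f g :: "'a \<Rightarrow> 'a"
    using that by (rule extensionalityI)
  show ?thesis
  proof (intro ringI abelian_groupI monoidI)
    fix f g assume f: "f \<in> carrier (End_ring G)" and g: "g \<in> carrier (End_ring G)"
    show "f \<oplus>\<^bsub>End_ring G\<^esub> g \<in> carrier (End_ring G)" "f \<otimes>\<^bsub>End_ring G\<^esub> g \<in> carrier (End_ring G)"
      unfolding ops by (rule EndI; simp add: homD f g m_ac)+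
    show "f \<oplus>\<^bsub>End_ring G\<^esub> g = g \<oplus>\<^bsub>End_ring G\<^esub> f"
      unfolding ops by (intro restrict_ext) (simp add: homD f g m_comm)
    fix h assume h: "h \<in> carrier (End_ring G)"
    show "f \<oplus>\<^bsub>End_ring G\<^esub> g \<oplus>\<^bsub>End_ring G\<^esub> h = f \<oplus>\<^bsub>End_ring G\<^esub> (g \<oplus>\<^bsub>End_ring G\<^esub> h)"
      "f \<otimes>\<^bsub>End_ring G\<^esub> g \<otimes>\<^bsub>End_ring G\<^esub> h = f \<otimes>\<^bsub>End_ring G\<^esub> (g \<otimes>\<^bsub>End_ring G\<^esub> h)"
      "(f \<oplus>\<^bsub>End_ring G\<^esub> g) \<otimes>\<^bsub>End_ring G\<^esub> h = f \<otimes>\<^bsub>End_ring G\<^esub> h \<oplus>\<^bsub>End_ring G\<^esub> g \<otimes>\<^bsub>End_ring G\<^esub> h"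
      "h \<otimes>\<^bsub>End_ring G\<^esub> (f \<oplus>\<^bsub>End_ring G\<^esub> g) = h \<otimes>\<^bsub>End_ring G\<^esub> f \<oplus>\<^bsub>End_ring G\<^esub> h \<otimes>\<^bsub>End_ring G\<^esub> g"
      unfolding ops by (intro restrict_ext; simp add: homD f g h m_assoc)+
  next
    fix f assume f: "f \<in> carrier (End_ring G)"
    show "\<zero>\<^bsub>End_ring G\<^esub> \<oplus>\<^bsub>End_ring G\<^esub> f = f" "\<one>\<^bsub>End_ring G\<^esub> \<otimes>\<^bsub>End_ring G\<^esub> f = f"
      "f \<otimes>\<^bsub>End_ring G\<^esub> \<one>\<^bsub>End_ring G\<^esub> = f"
      unfolding ops by (rule eqI; simp add: homD f EndD)+
    show "\<exists>g\<in>carrier (End_ring G). g \<oplus>\<^bsub>End_ring G\<^esub> f = \<zero>\<^bsub>End_ring G\<^esub>"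
    proof
      show "(\<lambda>x\<in>carrier G. inv (f x)) \<in> carrier (End_ring G)"
        by (rule EndI) (simp_all add: homD f inv_mult)
      show "(\<lambda>x\<in>carrier G. inv (f x)) \<oplus>\<^bsub>End_ring G\<^esub> f = \<zero>\<^bsub>End_ring G\<^esub>"
        unfolding ops by (intro restrict_ext) (simp add: homD f)
    qed
  next
    show "\<zero>\<^bsub>End_ring G\<^esub> \<in> carrier (End_ring G)" "\<one>\<^bsub>End_ring G\<^esub> \<in> carrier (End_ring G)"
      unfolding ops by (rule EndI; simp)+
  qed
qed

lemma (in group) mult_inv_cancel:
  assumes "x \<in> carrier G" "y \<in> carrier G"
  shows "x \<otimes> inv y \<otimes> y = x" "x \<otimes> y \<otimes> inv y = x" "inv x \<otimes> (x \<otimes> y) = y" "x \<otimes> (inv x \<otimes> y) = y"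
  using assms by (simp_all add: m_assoc) (simp_all flip: m_assoc)

text \<open>Left multiplication here is right multiplication in \<open>G\<close>, so results on
  martial operators specialise to partial ones.\<close>

definition opposite_group :: "'a monoid \<Rightarrow> 'a monoid" where
  "opposite_group G = \<lparr>carrier = carrier G, monoid.mult = (\<lambda>x y. y \<otimes>\<^bsub>G\<^esub> x), one = \<one>\<^bsub>G\<^esub>\<rparr>"

lemma opposite_group_simps [simp]:
  "carrier (opposite_group G) = carrier G"
  "x \<otimes>\<^bsub>opposite_group G\<^esub> y = y \<otimes>\<^bsub>G\<^esub> x"
  "\<one>\<^bsub>opposite_group G\<^esub> = \<one>\<^bsub>G\<^esub>"
  by (simp_all add: opposite_group_def)

lemma opposite_group_opposite_group [simp]: "opposite_group (opposite_group G) = G"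
  by (simp add: opposite_group_def)

lemma group_opposite_group:
  assumes "group G"
  shows "group (opposite_group G)"
proof -
  interpret group G by (rule assms)
  show ?thesis
    by (rule groupI) (auto simp: m_assoc intro!: bexI[of _ "inv\<^bsub>G\<^esub> _"])
qed

lemma inv_opposite_group:
  assumes "group G" "x \<in> carrier G"
  shows "inv\<^bsub>opposite_group G\<^esub> x = inv\<^bsub>G\<^esub> x"
proof -
  interpret group G by (rule assms)
  interpret op: group "opposite_group G" using assms(1) by (rule group_opposite_group)
  show ?thesis
    using assms by (intro op.inv_equality) auto
qed


section \<open>Endomorphisms of free abelian groups\<close>

abbreviation End_free :: "'a set \<Rightarrow> (('a \<Rightarrow>\<^sub>0 int) \<Rightarrow> ('a \<Rightarrow>\<^sub>0 int)) ring" where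
  "End_free S \<equiv> End_ring (free_Abelian_group S)"

lemma ring_End_free: "ring (End_free S)"
  by (intro ring_End_ring) (simp add: abelian_free_Abelian_group)

lemma End_free_add:
  "C \<in> carrier (End_free S) \<Longrightarrow> Poly_Mapping.keys x \<subseteq> S \<Longrightarrow> Poly_Mapping.keys y \<subseteq> S \<Longrightarrow>
    C (x + y) = C x + C y"
  by (auto simp: End_ring_def hom_def)

lemma keys_End_free:
  "C \<in> carrier (End_free S) \<Longrightarrow> Poly_Mapping.keys x \<subseteq> S \<Longrightarrow> Poly_Mapping.keys (C x) \<subseteq> S"
  unfolding End_ring_def hom_def by (simp add: Pi_iff)

lemma keys_frag_extend_subset:
  "(\<And>w. w \<in> S \<Longrightarrow> Poly_Mapping.keys (f w) \<subseteq> S) \<Longrightarrow> Poly_Mapping.keys x \<subseteq> S \<Longrightarrow>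
    Poly_Mapping.keys (frag_extend f x) \<subseteq> S"
  using keys_frag_extend[of f x] by blast

text \<open>The generators determine an additive map. \<open>frag_induction\<close> builds elements
  by differences, hence the detour through \<open>C_diff\<close>.\<close>

lemma End_free_eq_frag_extend:
  assumes C: "C \<in> carrier (End_free S)" and x: "Poly_Mapping.keys x \<subseteq> S"
  shows "C x = frag_extend (\<lambda>w. C (frag_of w)) x"
proof -
  have C0: "C 0 = 0" using End_free_add[OF C, of 0 0] by simp
  have C_diff: "C (a - b) = C a - C b"
    if "Poly_Mapping.keys a \<subseteq> S" "Poly_Mapping.keys b \<subseteq> S" for a b
  proof -
    have "Poly_Mapping.keys (a - b) \<subseteq> S" using that keys_diff[of a b] by auto
    from End_free_add[OF C this that(2)] show ?thesis by simp
  qed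
  \<comment> \<open>The support condition is carried through the induction because
    \<open>C_diff\<close> needs it for both arguments.\<close>
  have "Poly_Mapping.keys x \<subseteq> S \<and> C x = frag_extend (\<lambda>w. C (frag_of w)) x"
    using x
  proof (induction x rule: frag_induction)
    case (diff a b)
    then show ?case
      using keys_diff[of a b] by (auto simp: frag_extend_diff C_diff)
  qed (auto simp: C0)
  then show ?thesis ..
qed

lemma End_free_zero: "C \<in> carrier (End_free S) \<Longrightarrow> C 0 = 0"
  using End_free_eq_frag_extend[of C S 0] by simp

lemma End_free_cmul:
  "C \<in> carrier (End_free S) \<Longrightarrow> Poly_Mapping.keys x \<subseteq> S \<Longrightarrow>
    C (frag_cmul n x) = frag_cmul n (C x)"
  using End_free_eq_frag_extend[of C S x] End_free_eq_frag_extend[of C S "frag_cmul n x"]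
    keys_cmul[of n x]
  by (auto simp: frag_extend_cmul)

lemma End_free_sum:
  assumes "C \<in> carrier (End_free S)" "finite I" "\<And>i. i \<in> I \<Longrightarrow> Poly_Mapping.keys (g i) \<subseteq> S"
  shows "C (\<Sum>i\<in>I. g i) = (\<Sum>i\<in>I. C (g i))"
proof -
  have "Poly_Mapping.keys (\<Sum>i\<in>I. g i) \<subseteq> S"
    using assms(3) keys_sum[of g I] by fast
  then show ?thesis
    using assms by (simp add: End_free_eq_frag_extend frag_extend_sum)
qed

lemma frag_extend_in_End_free:
  assumes "\<And>w. w \<in> S \<Longrightarrow> Poly_Mapping.keys (f w) \<subseteq> S"
  shows "(\<lambda>x\<in>carrier (free_Abelian_group S). frag_extend f x) \<in> carrier (End_free S)"
proof -
  have "Poly_Mapping.keys (x + y) \<subseteq> S"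
    if "Poly_Mapping.keys x \<subseteq> S" "Poly_Mapping.keys y \<subseteq> S" for x y :: "'a \<Rightarrow>\<^sub>0 int"
    using that Poly_Mapping.keys_add[of x y] by blast
  then show ?thesis
    using keys_frag_extend_subset[of S f] assms
    by (simp add: End_ring_def hom_def Pi_iff frag_extend_add)
qed

text \<open>Used to reduce the operator identities below to a check on single group
  elements.\<close>

lemma End_free_eqI:
  assumes "C \<in> carrier (End_free S)" "C' \<in> carrier (End_free S)"
    and "\<And>w. w \<in> S \<Longrightarrow> C (frag_of w) = C' (frag_of w)"
  shows "C = C'"
proof (rule extensionalityI)
  show "C \<in> extensional (carrier (free_Abelian_group S))"
    "C' \<in> extensional (carrier (free_Abelian_group S))"
    using assms by (auto simp: End_ring_def)
next
  fix x :: "'a \<Rightarrow>\<^sub>0 int" assume "x \<in> carrier (free_Abelian_group S)"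
  then have x: "Poly_Mapping.keys x \<subseteq> S" by simp
  have "frag_extend (\<lambda>w. C (frag_of w)) x = frag_extend (\<lambda>w. C' (frag_of w)) x"
    by (rule frag_extend_eq) (use x assms(3) in blast)
  then show "C x = C' x"
    using End_free_eq_frag_extend[OF assms(1) x] End_free_eq_frag_extend[OF assms(2) x] by simp
qed

lemma End_free_mult_apply:
  "Poly_Mapping.keys x \<subseteq> S \<Longrightarrow> (C \<otimes>\<^bsub>End_free S\<^esub> C') x = C (C' x)"
  by (simp add: End_ring_def compose_def)

lemma End_free_mult_closed:
  "C \<in> carrier (End_free S) \<Longrightarrow> C' \<in> carrier (End_free S) \<Longrightarrow>
    C \<otimes>\<^bsub>End_free S\<^esub> C' \<in> carrier (End_free S)"
  by (rule ring.ring_simprules(5)[OF ring_End_free])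


section \<open>Nil Hecke algebras of groups with a length function\<close>

definition length_additive_pairs :: "'a monoid \<Rightarrow> ('a \<Rightarrow> nat) \<Rightarrow> 'a \<Rightarrow> ('a \<times> 'a) set" where
  "length_additive_pairs G l w =
    {(\<pi>, \<rho>). \<pi> \<in> carrier G \<and> \<rho> \<in> carrier G \<and> \<pi> \<otimes>\<^bsub>G\<^esub> \<rho> = w \<and> l w = l \<pi> + l \<rho>}"

text \<open>The record of \<open>Nil_algebra\<close> with the group as a parameter, so that it can
  be formed for the opposite group too.\<close>

definition nil_ring :: "'a monoid \<Rightarrow> ('a \<Rightarrow> nat) \<Rightarrow> ('a \<Rightarrow> int) ring" where
  "nil_ring G l =
    \<lparr>carrier = carrier G \<rightarrow>\<^sub>E UNIV,
     monoid.mult = (\<lambda>a b. \<lambda>w\<in>carrier G. \<Sum>(\<pi>, \<rho>)\<in>length_additive_pairs G l w. a \<pi> * b \<rho>),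
     one = (\<lambda>w\<in>carrier G. if w = \<one>\<^bsub>G\<^esub> then 1 else 0),
     zero = (\<lambda>w\<in>carrier G. 0),
     add = (\<lambda>a b. \<lambda>w\<in>carrier G. a w + b w)\<rparr>"

text \<open>For the Weyl group this is the martial operator of \<pi>, for its opposite group the
  partial one. The length condition is written as a sum to avoid truncated subtraction.\<close>

definition lowering :: "'a monoid \<Rightarrow> ('a \<Rightarrow> nat) \<Rightarrow> 'a \<Rightarrow> ('a \<Rightarrow>\<^sub>0 int) \<Rightarrow> ('a \<Rightarrow>\<^sub>0 int)" where
  "lowering G l \<pi> = (\<lambda>x\<in>carrier (free_Abelian_group (carrier G)). frag_extend
    (\<lambda>w. if l (\<pi> \<otimes>\<^bsub>G\<^esub> w) + l \<pi> = l w then frag_of (\<pi> \<otimes>\<^bsub>G\<^esub> w) else 0) x)"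

definition nil_action ::
    "'a monoid \<Rightarrow> ('a \<Rightarrow> nat) \<Rightarrow> ('a \<Rightarrow> int) \<Rightarrow> ('a \<Rightarrow>\<^sub>0 int) \<Rightarrow> ('a \<Rightarrow>\<^sub>0 int)" where
  "nil_action G l c = (\<lambda>x\<in>carrier (free_Abelian_group (carrier G)).
    \<Sum>\<pi> | \<pi> \<in> carrier G \<and> lowering G l \<pi> x \<noteq> 0. frag_cmul (c \<pi>) (lowering G l \<pi> x))"

text \<open>The axioms are invariant under passage to the opposite group and suffice for the
  commutant theorem; Weyl groups enter as an instance.\<close>

locale length_group = group G for G :: "'a monoid" (structure) +
  fixes l :: "'a \<Rightarrow> nat"
  assumes length_one: "l \<one> = 0"
    and length_eq_0D: "x \<in> carrier G \<Longrightarrow> l x = 0 \<Longrightarrow> x = \<one>"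
    and length_mult: "x \<in> carrier G \<Longrightarrow> y \<in> carrier G \<Longrightarrow> l (x \<otimes> y) \<le> l x + l y"
    and length_inv: "x \<in> carrier G \<Longrightarrow> l (inv x) = l x"
    and finite_length_additive_pairs: "w \<in> carrier G \<Longrightarrow> finite (length_additive_pairs G l w)"
begin

text \<open>Swapping the factors matches the length-additive pairs of the two groups, so finiteness
  carries over.\<close>

lemma length_group_opposite_group: "length_group (opposite_group G) l"
proof -
  interpret op: group "opposite_group G"
    by (rule group_opposite_group[OF is_group])
  show ?thesis
  proof
    fix w assume "w \<in> carrier (opposite_group G)"
    moreover have "length_additive_pairs (opposite_group G) l w =
        (\<lambda>(x, y). (y, x)) ` length_additive_pairs G l w"
      by (auto simp: length_additive_pairs_def image_iff)
    ultimately show "finite (length_additive_pairs (opposite_group G) l w)"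
      using finite_length_additive_pairs by simp
  next
    fix x y assume "x \<in> carrier (opposite_group G)" "y \<in> carrier (opposite_group G)"
    then show "l (x \<otimes>\<^bsub>opposite_group G\<^esub> y) \<le> l x + l y"
      using length_mult[of y x] by simp
  qed (use length_one length_eq_0D length_inv in \<open>auto simp: inv_opposite_group\<close>)
qed

text \<open>Subadditivity applied to \<open>y = inv x \<otimes> (x \<otimes> y)\<close>:
  multiplication by \<open>x\<close> drops the length by at most \<open>l x\<close>.\<close>

lemma length_le_mult_left:
  assumes "x \<in> carrier G" "y \<in> carrier G"
  shows "l y \<le> l (x \<otimes> y) + l x"
  using length_mult[of "inv x" "x \<otimes> y"] assms by (simp add: mult_inv_cancel length_inv)

lemma length_le_mult_right:
  assumes "x \<in> carrier G" "y \<in> carrier G"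
  shows "l x \<le> l (x \<otimes> y) + l y"
  using length_mult[of "x \<otimes> y" "inv y"] assms by (simp add: mult_inv_cancel length_inv)

text \<open>If \<pi> lowers \<open>w\<close>, then
  \<open>w = inv \<pi> \<otimes> (\<pi> \<otimes> w)\<close> is a length-additive factorization
  whose first factor determines \<pi>.\<close>

lemma finite_lowering_elements:
  assumes "w \<in> carrier G"
  shows "finite {\<pi> \<in> carrier G. l (\<pi> \<otimes> w) + l \<pi> = l w}" (is "finite ?P")
proof (rule finite_surj[OF finite_length_additive_pairs[OF assms]])
  show "?P \<subseteq> (\<lambda>(x, y). inv x) ` length_additive_pairs G l w"
  proof
    fix \<pi> assume "\<pi> \<in> ?P"
    then have "(inv \<pi>, \<pi> \<otimes> w) \<in> length_additive_pairs G l w"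
      using assms by (auto simp: length_additive_pairs_def length_inv mult_inv_cancel)
    then show "\<pi> \<in> (\<lambda>(x, y). inv x) ` length_additive_pairs G l w"
      using \<open>\<pi> \<in> ?P\<close> by force
  qed
qed

section \<open>Lowering operators and their infinite formal sums\<close>

lemma lowering_of:
  "w \<in> carrier G \<Longrightarrow> lowering G l \<pi> (frag_of w) =
    (if l (\<pi> \<otimes> w) + l \<pi> = l w then frag_of (\<pi> \<otimes> w) else 0)"
  by (simp add: lowering_def)

lemma lowering_End: "\<pi> \<in> carrier G \<Longrightarrow> lowering G l \<pi> \<in> carrier (End_free (carrier G))"
  unfolding lowering_def by (rule frag_extend_in_End_free) auto

text \<open>A nonzero value requires \<pi> to lower some element of the finite support of
  \<open>x\<close>. Without this finiteness the sum in \<open>nil_action\<close> would be 0 by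
  convention.\<close>

lemma finite_lowering_nonzero:
  assumes x: "Poly_Mapping.keys x \<subseteq> carrier G"
  shows "finite {\<pi> \<in> carrier G. lowering G l \<pi> x \<noteq> 0}"
proof (rule finite_subset)
  show "{\<pi> \<in> carrier G. lowering G l \<pi> x \<noteq> 0}
      \<subseteq> (\<Union>w\<in>Poly_Mapping.keys x. {\<pi> \<in> carrier G. l (\<pi> \<otimes> w) + l \<pi> = l w})"
  proof
    fix \<pi> assume \<pi>: "\<pi> \<in> {\<pi> \<in> carrier G. lowering G l \<pi> x \<noteq> 0}"
    show "\<pi> \<in> (\<Union>w\<in>Poly_Mapping.keys x. {\<pi> \<in> carrier G. l (\<pi> \<otimes> w) + l \<pi> = l w})"
    proof (rule ccontr)
      assume "\<not> ?thesis"
      then have "lowering G l \<pi> x = 0"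
        using \<pi> x by (auto simp: lowering_def intro!: frag_extend_eq_0)
      then show False
        using \<pi> by simp
    qed
  qed
  show "finite (\<Union>w\<in>Poly_Mapping.keys x. {\<pi> \<in> carrier G. l (\<pi> \<otimes> w) + l \<pi> = l w})"
    using x finite_lowering_elements by auto
qed

text \<open>The index set in \<open>nil_action\<close> depends on \<open>x\<close>; a larger finite
  set \<open>P\<close> allows sums for different arguments to be compared.\<close>

lemma nil_action_eq_sum:
  assumes "finite P" "P \<subseteq> carrier G" "Poly_Mapping.keys x \<subseteq> carrier G"
    and "\<And>\<pi>. \<pi> \<in> carrier G \<Longrightarrow> \<pi> \<notin> P \<Longrightarrow> lowering G l \<pi> x = 0"
  shows "nil_action G l c x = (\<Sum>\<pi>\<in>P. frag_cmul (c \<pi>) (lowering G l \<pi> x))"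
proof -
  have "(\<Sum>\<pi> | \<pi> \<in> carrier G \<and> lowering G l \<pi> x \<noteq> 0. frag_cmul (c \<pi>) (lowering G l \<pi> x)) =
      (\<Sum>\<pi>\<in>P. frag_cmul (c \<pi>) (lowering G l \<pi> x))"
    using assms by (intro sum.mono_neutral_left) auto
  then show ?thesis
    using assms(3) by (simp add: nil_action_def)
qed

lemma nil_action_End: "nil_action G l c \<in> carrier (End_free (carrier G))"
proof -
  let ?F = "free_Abelian_group (carrier G)"
  have "nil_action G l c \<in> hom ?F ?F"
  proof (rule homI)
    fix x assume "x \<in> carrier ?F"
    then have x: "Poly_Mapping.keys x \<subseteq> carrier G" by simp
    have "Poly_Mapping.keys (frag_cmul (c \<pi>) (lowering G l \<pi> x)) \<subseteq> carrier G"
      if "\<pi> \<in> carrier G" for \<pi>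
      using keys_End_free[OF lowering_End[OF that] x]
        keys_cmul[of "c \<pi>" "lowering G l \<pi> x"] by (rule order_trans[rotated])
    then have "(\<Union>\<pi>\<in>{\<pi> \<in> carrier G. lowering G l \<pi> x \<noteq> 0}.
        Poly_Mapping.keys (frag_cmul (c \<pi>) (lowering G l \<pi> x))) \<subseteq> carrier G"
      by blast
    then show "nil_action G l c x \<in> carrier ?F"
      using x order_trans[OF keys_sum] by (simp add: nil_action_def)
  next
    fix x y assume "x \<in> carrier ?F" "y \<in> carrier ?F"
    then have x: "Poly_Mapping.keys x \<subseteq> carrier G" and y: "Poly_Mapping.keys y \<subseteq> carrier G"
      and xy: "Poly_Mapping.keys (x + y) \<subseteq> carrier G"
      using Poly_Mapping.keys_add[of x y] by auto
    \<comment> \<open>A common index set for the three sums at \<open>x\<close>, \<open>y\<close>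
      and \<open>x + y\<close>.\<close>
    define P where "P = {\<pi> \<in> carrier G. lowering G l \<pi> x \<noteq> 0} \<union>
      {\<pi> \<in> carrier G. lowering G l \<pi> y \<noteq> 0}"
    have P: "finite P" "P \<subseteq> carrier G"
      using finite_lowering_nonzero x y by (auto simp: P_def)
    have add: "lowering G l \<pi> (x + y) = lowering G l \<pi> x + lowering G l \<pi> y"
      if "\<pi> \<in> carrier G" for \<pi>
      using End_free_add[OF lowering_End[OF that] x y] .
    have "nil_action G l c (x + y) = (\<Sum>\<pi>\<in>P. frag_cmul (c \<pi>) (lowering G l \<pi> (x + y)))"
      by (rule nil_action_eq_sum[OF P xy]) (auto simp: P_def add)
    also have "\<dots> = (\<Sum>\<pi>\<in>P. frag_cmul (c \<pi>) (lowering G l \<pi> x) + frag_cmul (c \<pi>) (lowering G l \<pi> y))"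
      using P by (intro sum.cong) (auto simp: add frag_cmul_distrib2)
    also have "\<dots> = nil_action G l c x + nil_action G l c y"
      using nil_action_eq_sum[OF P x] nil_action_eq_sum[OF P y] by (auto simp: P_def sum.distrib)
    finally show "nil_action G l c (x \<otimes>\<^bsub>?F\<^esub> y) = nil_action G l c x \<otimes>\<^bsub>?F\<^esub> nil_action G l c y"
      by simp
  qed
  then show ?thesis
    by (simp add: End_ring_def nil_action_def)
qed

text \<open>Only \<open>\<pi> = v \<otimes> inv w\<close> can carry \<open>w\<close> to
  \<open>v\<close>, so the sum collapses to at most one term.\<close>

lemma lookup_nil_action_of:
  assumes w: "w \<in> carrier G"
  shows "Poly_Mapping.lookup (nil_action G l c (frag_of w)) v =
    (if v \<in> carrier G \<and> l v + l (v \<otimes> inv w) = l w then c (v \<otimes> inv w) else 0)"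
proof -
  define P where "P = {\<pi> \<in> carrier G. l (\<pi> \<otimes> w) + l \<pi> = l w}"
  have P: "finite P" "P \<subseteq> carrier G"
    using finite_lowering_elements[OF w] by (auto simp: P_def)
  have "nil_action G l c (frag_of w) = (\<Sum>\<pi>\<in>P. frag_cmul (c \<pi>) (lowering G l \<pi> (frag_of w)))"
    using w by (intro nil_action_eq_sum[OF P]) (auto simp: lowering_of P_def)
  also have "\<dots> = (\<Sum>\<pi>\<in>P. frag_cmul (c \<pi>) (frag_of (\<pi> \<otimes> w)))"
    using w by (intro sum.cong) (auto simp: lowering_of P_def)
  finally have "Poly_Mapping.lookup (nil_action G l c (frag_of w)) v = (\<Sum>\<pi>\<in>P. if v = \<pi> \<otimes> w then c \<pi> else 0)"
    by (simp add: lookup_sum if_distrib cong: if_cong)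
  \<comment> \<open>Here \<open>v\<close> ranges over the whole type, so solving for \<pi> must
    record that \<open>v\<close> lies in the group.\<close>
  also have "\<dots> = (\<Sum>\<pi>\<in>P. if \<pi> = v \<otimes> inv w \<and> v \<in> carrier G then c \<pi> else 0)"
    using w P(2) by (intro sum.cong) (auto simp: mult_inv_cancel)
  also have "\<dots> = (if v \<otimes> inv w \<in> P \<and> v \<in> carrier G then c (v \<otimes> inv w) else 0)"
    using P(1) by (cases "v \<in> carrier G") auto
  also have "v \<otimes> inv w \<in> P \<and> v \<in> carrier G \<longleftrightarrow> v \<in> carrier G \<and> l v + l (v \<otimes> inv w) = l w"
    using w by (auto simp: P_def mult_inv_cancel)
  finally show ?thesis .
qed

text \<open>At \<open>w = inv \<pi>\<close> and \<open>v = \<one>\<close> the length condition reads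
  \<open>0 + l \<pi> = l (inv \<pi>)\<close> and always holds. Hence the operator determines its
  coefficients.\<close>

lemma nil_action_coefficient:
  "\<pi> \<in> carrier G \<Longrightarrow> Poly_Mapping.lookup (nil_action G l c (frag_of (inv \<pi>))) \<one> = c \<pi>"
  by (simp add: lookup_nil_action_of length_one length_inv)

lemma nil_action_inj:
  assumes "nil_action G l a = nil_action G l b" "a \<in> carrier (nil_ring G l)" "b \<in> carrier (nil_ring G l)"
  shows "a = b"
proof (rule extensionalityI)
  show "a \<in> extensional (carrier G)" "b \<in> extensional (carrier G)"
    using assms(2,3) by (simp_all add: nil_ring_def PiE_def)
  show "a \<pi> = b \<pi>" if "\<pi> \<in> carrier G" for \<pi>
    using nil_action_coefficient[OF that, of a] nil_action_coefficient[OF that, of b] assms(1)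
    by simp
qed

section \<open>Composition and commutation of lowering operators\<close>

lemma lowering_one: "lowering G l \<one> = \<one>\<^bsub>End_free (carrier G)\<^esub>"
proof (rule End_free_eqI[OF lowering_End])
  show "\<one>\<^bsub>End_free (carrier G)\<^esub> \<in> carrier (End_free (carrier G))"
    by (rule ring.ring_simprules(6)[OF ring_End_free])
qed (simp_all add: lowering_of length_one End_ring_def)

text \<open>Each factor drops the length by at most its own length, so a total drop of
  \<open>l \<pi> + l \<rho>\<close> occurs exactly when both single drops are maximal.\<close>

lemma lowering_mult:
  assumes "\<pi> \<in> carrier G" "\<rho> \<in> carrier G" "l (\<pi> \<otimes> \<rho>) = l \<pi> + l \<rho>"
  shows "lowering G l \<pi> \<otimes>\<^bsub>End_free (carrier G)\<^esub> lowering G l \<rho> = lowering G l (\<pi> \<otimes> \<rho>)"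
proof (rule End_free_eqI)
  fix w assume w: "w \<in> carrier G"
  show "(lowering G l \<pi> \<otimes>\<^bsub>End_free (carrier G)\<^esub> lowering G l \<rho>) (frag_of w) =
      lowering G l (\<pi> \<otimes> \<rho>) (frag_of w)"
    using assms w length_le_mult_left[of \<pi> "\<rho> \<otimes> w"] length_le_mult_left[of \<rho> w]
      End_free_zero[OF lowering_End[OF assms(1)]]
    by (auto simp: End_free_mult_apply lowering_of m_assoc)
qed (use assms in \<open>auto intro: End_free_mult_closed lowering_End\<close>)

text \<open>In either order the result is \<open>\<pi> \<otimes> w \<otimes> \<rho>\<close> if the
  total drop is the maximal \<open>l \<pi> + l \<rho>\<close>, and 0 otherwise.\<close>

lemma lowering_opposite_commute:
  assumes "\<pi> \<in> carrier G" "\<rho> \<in> carrier G"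
  shows "lowering G l \<pi> \<otimes>\<^bsub>End_free (carrier G)\<^esub> lowering (opposite_group G) l \<rho> =
    lowering (opposite_group G) l \<rho> \<otimes>\<^bsub>End_free (carrier G)\<^esub> lowering G l \<pi>"
proof -
  interpret op: length_group "opposite_group G" l by (rule length_group_opposite_group)
  have L: "lowering G l \<pi> \<in> carrier (End_free (carrier G))"
    using assms by (rule_tac lowering_End)
  have R: "lowering (opposite_group G) l \<rho> \<in> carrier (End_free (carrier G))"
    using op.lowering_End assms by simp
  show ?thesis
  proof (rule End_free_eqI)
    fix w assume w: "w \<in> carrier G"
    have "lowering G l \<pi> (lowering (opposite_group G) l \<rho> (frag_of w)) =
      (if l (\<pi> \<otimes> w \<otimes> \<rho>) + l \<pi> + l \<rho> = l w then frag_of (\<pi> \<otimes> w \<otimes> \<rho>) else 0)"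
      using assms w length_le_mult_left[of \<pi> "w \<otimes> \<rho>"] length_le_mult_right[of w \<rho>]
      by (auto simp: lowering_of op.lowering_of End_free_zero[OF L] m_assoc)
    moreover have "lowering (opposite_group G) l \<rho> (lowering G l \<pi> (frag_of w)) =
      (if l (\<pi> \<otimes> w \<otimes> \<rho>) + l \<pi> + l \<rho> = l w then frag_of (\<pi> \<otimes> w \<otimes> \<rho>) else 0)"
      using assms w length_le_mult_left[of \<pi> w] length_le_mult_right[of "\<pi> \<otimes> w" \<rho>]
      by (auto simp: lowering_of op.lowering_of End_free_zero[OF R])
    ultimately show "(lowering G l \<pi> \<otimes>\<^bsub>End_free (carrier G)\<^esub> lowering (opposite_group G) l \<rho>) (frag_of w) =
      (lowering (opposite_group G) l \<rho> \<otimes>\<^bsub>End_free (carrier G)\<^esub> lowering G l \<pi>) (frag_of w)"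
      using w by (simp add: End_free_mult_apply)
  qed (use L R in \<open>auto intro: End_free_mult_closed\<close>)
qed

text \<open>On a fixed argument the infinite sum is finite, so \<open>C\<close> can be moved through
  it term by term.\<close>

lemma nil_action_commute:
  assumes C: "C \<in> carrier (End_free (carrier G))"
    and comm: "\<And>\<pi>. \<pi> \<in> carrier G \<Longrightarrow>
      C \<otimes>\<^bsub>End_free (carrier G)\<^esub> lowering G l \<pi> = lowering G l \<pi> \<otimes>\<^bsub>End_free (carrier G)\<^esub> C"
  shows "C \<otimes>\<^bsub>End_free (carrier G)\<^esub> nil_action G l c = nil_action G l c \<otimes>\<^bsub>End_free (carrier G)\<^esub> C"
proof (rule End_free_eqI)
  fix w assume w: "w \<in> carrier G"
  define x where "x = frag_of w"
  have x: "Poly_Mapping.keys x \<subseteq> carrier G" using w by (simp add: x_def)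
  note Cx = keys_End_free[OF C x]
  have C_lowering: "C (lowering G l \<pi> x) = lowering G l \<pi> (C x)" if "\<pi> \<in> carrier G" for \<pi>
    using arg_cong[OF comm[OF that], of "\<lambda>f. f x"] x by (simp add: End_free_mult_apply)
  note keys_lowering = keys_End_free[OF lowering_End x]
  define P where "P = {\<pi> \<in> carrier G. lowering G l \<pi> x \<noteq> 0}"
  have P: "finite P" "P \<subseteq> carrier G"
    using finite_lowering_nonzero x by (auto simp: P_def)
  have "C (nil_action G l c x) = C (\<Sum>\<pi>\<in>P. frag_cmul (c \<pi>) (lowering G l \<pi> x))"
    by (subst nil_action_eq_sum[OF P x]) (auto simp: P_def)
  also have "\<dots> = (\<Sum>\<pi>\<in>P. C (frag_cmul (c \<pi>) (lowering G l \<pi> x)))"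
    using P keys_lowering keys_cmul by (intro End_free_sum[OF C]) blast+
  also have "\<dots> = (\<Sum>\<pi>\<in>P. frag_cmul (c \<pi>) (lowering G l \<pi> (C x)))"
    using P keys_lowering by (intro sum.cong) (auto simp: End_free_cmul[OF C] C_lowering subset_iff)
  \<comment> \<open>The index set chosen for \<open>x\<close> also serves \<open>C x\<close>:
    outside it, lowering \<open>C x\<close> gives \<open>C 0 = 0\<close>.\<close>
  also have "\<dots> = nil_action G l c (C x)"
    by (rule nil_action_eq_sum[OF P Cx, symmetric])
      (auto simp: P_def End_free_zero[OF C] simp flip: C_lowering)
  finally show "(C \<otimes>\<^bsub>End_free (carrier G)\<^esub> nil_action G l c) (frag_of w) =
      (nil_action G l c \<otimes>\<^bsub>End_free (carrier G)\<^esub> C) (frag_of w)"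
    using w by (simp add: End_free_mult_apply x_def)
qed (auto intro: End_free_mult_closed C nil_action_End)

text \<open>\<open>nil_action_commute\<close> is used twice, first to pass to infinite sums on the
  left side and then, in the opposite group, on the right side.\<close>

lemma nil_action_opposite_commute:
  "nil_action G l a \<otimes>\<^bsub>End_free (carrier G)\<^esub> nil_action (opposite_group G) l b =
    nil_action (opposite_group G) l b \<otimes>\<^bsub>End_free (carrier G)\<^esub> nil_action G l a"
proof -
  interpret op: length_group "opposite_group G" l by (rule length_group_opposite_group)
  have "lowering (opposite_group G) l \<rho> \<otimes>\<^bsub>End_free (carrier G)\<^esub> nil_action G l a =
      nil_action G l a \<otimes>\<^bsub>End_free (carrier G)\<^esub> lowering (opposite_group G) l \<rho>"
    if "\<rho> \<in> carrier G" for \<rho>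
    using that op.lowering_End[of \<rho>]
    by (intro nil_action_commute) (auto simp: lowering_opposite_commute)
  then show ?thesis
    using op.nil_action_commute[of "nil_action G l a" b] nil_action_End by simp
qed

text \<open>
  An operator commuting with all right lowering operators is determined by its components at the
  identity, since the coefficient of \<open>v\<close> in \<open>y\<close> is that of \<open>\<one>\<close> in the image of \<open>y\<close> under the right
  lowering operator of \<open>inv v\<close>.
\<close>

lemma commuting_eq_nil_action:
  assumes C: "C \<in> carrier (End_free (carrier G))"
    and comm: "\<And>\<rho>. \<rho> \<in> carrier G \<Longrightarrow>
      C \<otimes>\<^bsub>End_free (carrier G)\<^esub> lowering (opposite_group G) l \<rho> =
      lowering (opposite_group G) l \<rho> \<otimes>\<^bsub>End_free (carrier G)\<^esub> C"
  shows "C = nil_action G l (\<lambda>\<pi>\<in>carrier G. Poly_Mapping.lookup (C (frag_of (inv \<pi>))) \<one>)"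
    (is "C = nil_action G l ?c")
proof (rule End_free_eqI[OF C nil_action_End])
  fix w assume w: "w \<in> carrier G"
  interpret op: length_group "opposite_group G" l by (rule length_group_opposite_group)
  let ?R = "lowering (opposite_group G) l"
  have coeff: "Poly_Mapping.lookup (?R (inv v) y) \<one> = Poly_Mapping.lookup y v"
    if v: "v \<in> carrier G" and y: "Poly_Mapping.keys y \<subseteq> carrier G" for v y
  proof -
    have "Poly_Mapping.lookup (?R (inv v) y) \<one> =
      (\<Sum>u\<in>Poly_Mapping.keys y. Poly_Mapping.lookup y u *
        Poly_Mapping.lookup (if l (u \<otimes> inv v) + l (inv v) = l u then frag_of (u \<otimes> inv v) else 0) \<one>)"
      using y by (simp add: lowering_def frag_extend_def lookup_sum cong: if_cong)
    also have "\<dots> = (\<Sum>u\<in>Poly_Mapping.keys y. if u = v then Poly_Mapping.lookup y u else 0)"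
    proof (rule sum.cong[OF HOL.refl])
      fix u assume "u \<in> Poly_Mapping.keys y"
      then have u: "u \<in> carrier G" using y by auto
      \<comment> \<open>Only \<open>u = v\<close> reaches the identity, and there the length
        condition is \<open>0 + l (inv v) = l v\<close>.\<close>
      have "\<one> = u \<otimes> inv v \<longleftrightarrow> u = v"
        using u v by (metis inv_closed inv_equality inv_inv r_inv)
      then show "Poly_Mapping.lookup y u * Poly_Mapping.lookup (if l (u \<otimes> inv v) + l (inv v) = l u
          then frag_of (u \<otimes> inv v) else 0) \<one> = (if u = v then Poly_Mapping.lookup y u else 0)"
        using v by (auto simp: length_inv length_one)
    qed
    finally show ?thesis
      by (auto simp: in_keys_iff)
  qed
  have keys: "Poly_Mapping.keys (C (frag_of w)) \<subseteq> carrier G"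
    using w by (intro keys_End_free[OF C]) simp
  show "C (frag_of w) = nil_action G l ?c (frag_of w)"
  proof (rule poly_mapping_eqI)
    fix v
    show "Poly_Mapping.lookup (C (frag_of w)) v = Poly_Mapping.lookup (nil_action G l ?c (frag_of w)) v"
    proof (cases "v \<in> carrier G")
      case False
      then show ?thesis
        using keys w by (auto simp: lookup_nil_action_of in_keys_iff)
    next
      case v: True
      \<comment> \<open>The right lowering operator yields a condition on
        \<open>w \<otimes> inv v\<close>, \<open>lookup_nil_action_of\<close> one on its inverse;
        the two have equal length.\<close>
      have inv: "inv (v \<otimes> inv w) = w \<otimes> inv v"
        using v w by (simp add: inv_mult_group)
      have "Poly_Mapping.lookup (C (frag_of w)) v = Poly_Mapping.lookup (?R (inv v) (C (frag_of w))) \<one>"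
        using coeff v keys by simp
      also have "?R (inv v) (C (frag_of w)) = C (?R (inv v) (frag_of w))"
        using arg_cong[OF comm[of "inv v"], of "\<lambda>f. f (frag_of w)"] v w
        by (simp add: End_free_mult_apply)
      also have "Poly_Mapping.lookup (C (?R (inv v) (frag_of w))) \<one> =
          (if l (w \<otimes> inv v) + l v = l w then Poly_Mapping.lookup (C (frag_of (w \<otimes> inv v))) \<one> else 0)"
        using v w by (simp add: op.lowering_of length_inv End_free_zero[OF C])
      also have "\<dots> = Poly_Mapping.lookup (nil_action G l ?c (frag_of w)) v"
        using v w inv length_inv[of "v \<otimes> inv w"] by (auto simp: lookup_nil_action_of)
      finally show ?thesis .
    qed
  qed
qed

section \<open>The action as a ring homomorphism, and its commutant\<close>

lemma nil_action_one: "nil_action G l \<one>\<^bsub>nil_ring G l\<^esub> = \<one>\<^bsub>End_free (carrier G)\<^esub>"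
proof (rule End_free_eqI[OF nil_action_End])
  show "\<one>\<^bsub>End_free (carrier G)\<^esub> \<in> carrier (End_free (carrier G))"
    by (rule ring.ring_simprules(6)[OF ring_End_free])
  fix w assume w: "w \<in> carrier G"
  have "v \<otimes> inv w = \<one> \<longleftrightarrow> v = w" if "v \<in> carrier G" for v
    using that w by (metis inv_closed inv_equality inv_inv r_inv)
  then have "nil_action G l \<one>\<^bsub>nil_ring G l\<^esub> (frag_of w) = frag_of w"
    using w by (intro poly_mapping_eqI) (auto simp: lookup_nil_action_of nil_ring_def length_one)
  then show "nil_action G l \<one>\<^bsub>nil_ring G l\<^esub> (frag_of w) = \<one>\<^bsub>End_free (carrier G)\<^esub> (frag_of w)"
    using w by (simp add: End_ring_def)
qed

lemma nil_action_zero: "nil_action G l \<zero>\<^bsub>nil_ring G l\<^esub> = \<zero>\<^bsub>End_free (carrier G)\<^esub>"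
proof (rule End_free_eqI[OF nil_action_End])
  show "\<zero>\<^bsub>End_free (carrier G)\<^esub> \<in> carrier (End_free (carrier G))"
    by (rule ring.ring_simprules(2)[OF ring_End_free])
  fix w assume w: "w \<in> carrier G"
  have "nil_action G l \<zero>\<^bsub>nil_ring G l\<^esub> (frag_of w) = 0"
    using w by (intro poly_mapping_eqI) (simp add: lookup_nil_action_of nil_ring_def)
  then show "nil_action G l \<zero>\<^bsub>nil_ring G l\<^esub> (frag_of w) = \<zero>\<^bsub>End_free (carrier G)\<^esub> (frag_of w)"
    using w by (simp add: End_ring_def)
qed

lemma nil_action_add:
  "nil_action G l (a \<oplus>\<^bsub>nil_ring G l\<^esub> b) = nil_action G l a \<oplus>\<^bsub>End_free (carrier G)\<^esub> nil_action G l b"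
proof (rule End_free_eqI[OF nil_action_End])
  show "nil_action G l a \<oplus>\<^bsub>End_free (carrier G)\<^esub> nil_action G l b \<in> carrier (End_free (carrier G))"
    by (intro ring.ring_simprules(1)[OF ring_End_free] nil_action_End)
  fix w assume w: "w \<in> carrier G"
  have "nil_action G l (a \<oplus>\<^bsub>nil_ring G l\<^esub> b) (frag_of w) =
      nil_action G l a (frag_of w) + nil_action G l b (frag_of w)"
    using w by (intro poly_mapping_eqI) (simp add: lookup_nil_action_of lookup_add nil_ring_def)
  then show "nil_action G l (a \<oplus>\<^bsub>nil_ring G l\<^esub> b) (frag_of w) =
      (nil_action G l a \<oplus>\<^bsub>End_free (carrier G)\<^esub> nil_action G l b) (frag_of w)"
    using w by (simp add: End_ring_def)
qed

text \<open>
  A product of two actions commutes with all right lowering operators, so it is enough to compare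
  the coefficients of the identity.
\<close>

lemma nil_action_mult:
  "nil_action G l (a \<otimes>\<^bsub>nil_ring G l\<^esub> b) = nil_action G l a \<otimes>\<^bsub>End_free (carrier G)\<^esub> nil_action G l b"
proof -
  interpret op: length_group "opposite_group G" l by (rule length_group_opposite_group)
  let ?E = "End_free (carrier G)"
  interpret E: ring ?E by (rule ring_End_free)
  define C where "C = nil_action G l a \<otimes>\<^bsub>?E\<^esub> nil_action G l b"
  have C: "C \<in> carrier ?E"
    unfolding C_def by (intro E.m_closed nil_action_End)
  have comm: "C \<otimes>\<^bsub>?E\<^esub> lowering (opposite_group G) l \<rho> = lowering (opposite_group G) l \<rho> \<otimes>\<^bsub>?E\<^esub> C"
    if "\<rho> \<in> carrier G" for \<rho>
  proof -
    have R: "lowering (opposite_group G) l \<rho> \<in> carrier ?E"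
      using op.lowering_End that by simp
    have "nil_action G l c \<otimes>\<^bsub>?E\<^esub> lowering (opposite_group G) l \<rho> =
        lowering (opposite_group G) l \<rho> \<otimes>\<^bsub>?E\<^esub> nil_action G l c" for c
      using that R by (intro nil_action_commute[symmetric]) (auto simp: lowering_opposite_commute)
    then show ?thesis
      unfolding C_def using R nil_action_End E.m_assoc by metis
  qed
  have "Poly_Mapping.lookup (C (frag_of (inv w))) \<one> = (a \<otimes>\<^bsub>nil_ring G l\<^esub> b) w" if w: "w \<in> carrier G" for w
  proof -
    define P where "P = {\<rho> \<in> carrier G. l (\<rho> \<otimes> inv w) + l \<rho> = l (inv w)}"
    have P: "finite P" "P \<subseteq> carrier G"
      using finite_lowering_elements[of "inv w"] w by (auto simp: P_def)
    have "nil_action G l b (frag_of (inv w)) =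
        (\<Sum>\<rho>\<in>P. frag_cmul (b \<rho>) (lowering G l \<rho> (frag_of (inv w))))"
      using w by (intro nil_action_eq_sum[OF P]) (auto simp: lowering_of P_def)
    also have "\<dots> = (\<Sum>\<rho>\<in>P. frag_cmul (b \<rho>) (frag_of (\<rho> \<otimes> inv w)))"
      using w by (intro sum.cong) (auto simp: lowering_of P_def)
    finally have "C (frag_of (inv w)) =
        nil_action G l a (\<Sum>\<rho>\<in>P. frag_cmul (b \<rho>) (frag_of (\<rho> \<otimes> inv w)))"
      using w by (simp add: C_def End_free_mult_apply)
    also have "\<dots> = (\<Sum>\<rho>\<in>P. nil_action G l a (frag_cmul (b \<rho>) (frag_of (\<rho> \<otimes> inv w))))"
      using P w by (intro End_free_sum[OF nil_action_End]) auto
    also have "\<dots> = (\<Sum>\<rho>\<in>P. frag_cmul (b \<rho>) (nil_action G l a (frag_of (\<rho> \<otimes> inv w))))"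
      using P w by (intro sum.cong End_free_cmul[OF nil_action_End]) auto
    finally have "Poly_Mapping.lookup (C (frag_of (inv w))) \<one> =
        (\<Sum>\<rho>\<in>P. b \<rho> * Poly_Mapping.lookup (nil_action G l a (frag_of (\<rho> \<otimes> inv w))) \<one>)"
      by (simp add: lookup_sum)
    also have "\<dots> = (\<Sum>\<rho>\<in>P. a (w \<otimes> inv \<rho>) * b \<rho>)"
    proof (rule sum.cong[OF HOL.refl])
      fix \<rho> assume "\<rho> \<in> P"
      then have \<rho>: "\<rho> \<in> carrier G" using P by auto
      \<comment> \<open>Written as an inverse, so that \<open>nil_action_coefficient\<close> reads
        off a coefficient of \<open>a\<close>.\<close>
      have "\<rho> \<otimes> inv w = inv (w \<otimes> inv \<rho>)"
        using \<rho> w by (simp add: inv_mult_group)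
      then show "b \<rho> * Poly_Mapping.lookup (nil_action G l a (frag_of (\<rho> \<otimes> inv w))) \<one> = a (w \<otimes> inv \<rho>) * b \<rho>"
        using nil_action_coefficient[of "w \<otimes> inv \<rho>" a] \<rho> w by simp
    qed
    \<comment> \<open>The second factor \<rho> determines the first as
      \<open>w \<otimes> inv \<rho>\<close>, and membership in \<open>P\<close> is length-additivity
      of this factorization.\<close>
    also have "\<dots> = (\<Sum>(\<pi>, \<rho>)\<in>length_additive_pairs G l w. a \<pi> * b \<rho>)"
    proof (rule sum.reindex_bij_witness[where i = snd and j = "\<lambda>\<rho>. (w \<otimes> inv \<rho>, \<rho>)"])
      fix \<rho> assume "\<rho> \<in> P"
      then have \<rho>: "\<rho> \<in> carrier G" and len: "l (\<rho> \<otimes> inv w) + l \<rho> = l w"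
        using w by (auto simp: P_def length_inv)
      have "l (w \<otimes> inv \<rho>) = l (\<rho> \<otimes> inv w)"
        using length_inv[of "w \<otimes> inv \<rho>"] \<rho> w by (simp add: inv_mult_group)
      then show "(w \<otimes> inv \<rho>, \<rho>) \<in> length_additive_pairs G l w"
        using \<rho> w len by (simp add: length_additive_pairs_def mult_inv_cancel)
    next
      fix p assume p: "p \<in> length_additive_pairs G l w"
      obtain \<pi> \<rho> where p_eq: "p = (\<pi>, \<rho>)" by (cases p)
      have \<pi>: "\<pi> \<in> carrier G" and \<rho>: "\<rho> \<in> carrier G" and w_eq: "w = \<pi> \<otimes> \<rho>"
        and len: "l w = l \<pi> + l \<rho>"
        using p p_eq by (auto simp: length_additive_pairs_def)
      have \<pi>_eq: "w \<otimes> inv \<rho> = \<pi>"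
        using \<pi> \<rho> w_eq by (simp add: mult_inv_cancel)
      have "\<rho> \<otimes> inv w = inv \<pi>"
        using \<pi> \<rho> by (simp add: w_eq inv_mult_group mult_inv_cancel)
      then show "snd p \<in> P"
        using p_eq \<pi> \<rho> w len by (simp add: P_def length_inv)
      show "(w \<otimes> inv (snd p), snd p) = p"
        using p_eq \<pi>_eq by simp
    qed auto
    also have "\<dots> = (a \<otimes>\<^bsub>nil_ring G l\<^esub> b) w"
      using w by (simp add: nil_ring_def)
    finally show ?thesis .
  qed
  then have "(\<lambda>w\<in>carrier G. Poly_Mapping.lookup (C (frag_of (inv w))) \<one>) = a \<otimes>\<^bsub>nil_ring G l\<^esub> b"
    by (auto simp: nil_ring_def fun_eq_iff)
  then show ?thesis
    using commuting_eq_nil_action[OF C comm] by (simp add: C_def)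
qed

lemma ring_hom_nil_action: "ring_hom_ring (nil_ring G l) (End_free (carrier G)) (nil_action G l)"
proof (rule ring_hom_ringI)
  show "ring (nil_ring G l)"
  proof (rule ring_pullback[OF ring_End_free[of "carrier G"], where h = "nil_action G l"])
    show "inj_on (nil_action G l) (carrier (nil_ring G l))"
      by (rule inj_onI) (rule nil_action_inj)
    fix a assume a: "a \<in> carrier (nil_ring G l)"
    show "\<exists>b\<in>carrier (nil_ring G l). b \<oplus>\<^bsub>nil_ring G l\<^esub> a = \<zero>\<^bsub>nil_ring G l\<^esub>"
      by (rule bexI[of _ "\<lambda>w\<in>carrier G. - a w"]) (auto simp: nil_ring_def)
  qed (simp_all add: nil_action_End nil_action_mult nil_action_add nil_action_one nil_action_zero,
      simp_all add: nil_ring_def)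
qed (simp_all add: ring_End_free nil_action_End nil_action_mult nil_action_add nil_action_one)

text \<open>Places the lowering operators in the image of the action, so that commuting with the
  image includes commuting with each of them.\<close>

lemma lowering_eq_nil_action:
  assumes \<pi>: "\<pi> \<in> carrier G"
  shows "lowering G l \<pi> = nil_action G l (\<lambda>w\<in>carrier G. if w = \<pi> then 1 else 0)"
proof (rule End_free_eqI[OF lowering_End[OF \<pi>] nil_action_End])
  fix w assume w: "w \<in> carrier G"
  have "v \<otimes> inv w = \<pi> \<longleftrightarrow> v = \<pi> \<otimes> w" if "v \<in> carrier G" for v
    using that w \<pi> by (auto simp: mult_inv_cancel)
  then show "lowering G l \<pi> (frag_of w) =
      nil_action G l (\<lambda>w\<in>carrier G. if w = \<pi> then 1 else 0) (frag_of w)"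
    using w \<pi> by (intro poly_mapping_eqI)
      (auto simp: lookup_nil_action_of lowering_of mult_inv_cancel)
qed

text \<open>One inclusion is the commutation of the two actions, the other
  \<open>commuting_eq_nil_action\<close>. Its instance for the opposite group gives the second
  commutant.\<close>

lemma commutant_nil_action_opposite:
  "commutant (End_free (carrier G)) (nil_action (opposite_group G) l ` carrier (nil_ring (opposite_group G) l)) =
    nil_action G l ` carrier (nil_ring G l)" (is "?L = ?R")
proof
  interpret op: length_group "opposite_group G" l by (rule length_group_opposite_group)
  show "?R \<subseteq> ?L"
    by (auto simp: commutant_def nil_action_End nil_action_opposite_commute)
  show "?L \<subseteq> ?R"
  proof
    fix C assume C: "C \<in> ?L"
    have "C = nil_action G l (\<lambda>\<pi>\<in>carrier G. Poly_Mapping.lookup (C (frag_of (inv \<pi>))) \<one>)"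
    proof (rule commuting_eq_nil_action)
      fix \<rho> assume \<rho>: "\<rho> \<in> carrier G"
      have "lowering (opposite_group G) l \<rho> \<in>
          nil_action (opposite_group G) l ` carrier (nil_ring (opposite_group G) l)"
        using \<rho> by (subst op.lowering_eq_nil_action) (auto simp: nil_ring_def)
      then show "C \<otimes>\<^bsub>End_free (carrier G)\<^esub> lowering (opposite_group G) l \<rho> =
          lowering (opposite_group G) l \<rho> \<otimes>\<^bsub>End_free (carrier G)\<^esub> C"
        using C unfolding commutant_def by blast
    qed (use C in \<open>simp add: commutant_def\<close>)
    then show "C \<in> ?R"
      by (auto simp: nil_ring_def intro: image_eqI)
  qed
qed

end

text \<open>Swapping the factors of each factorization reverses the product. This turns the action
  for the opposite group into one of the opposite algebra.\<close>

lemma nil_ring_opposite_group: "nil_ring (opposite_group G) l = opposite_ring (nil_ring G l)"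
proof -
  have "(\<Sum>(\<pi>, \<rho>)\<in>length_additive_pairs (opposite_group G) l w. a \<pi> * b \<rho>) =
      (\<Sum>(\<pi>, \<rho>)\<in>length_additive_pairs G l w. b \<pi> * a \<rho>)" for w and a b :: "'a \<Rightarrow> int"
    by (rule sum.reindex_bij_witness[where i = "\<lambda>(x, y). (y, x)" and j = "\<lambda>(x, y). (y, x)"])
      (auto simp: length_additive_pairs_def)
  then show ?thesis
    by (simp add: nil_ring_def opposite_ring_def)
qed


section \<open>Words and length in Weyl groups\<close>

declare in_lists_conv_set [simp] ball_Un [simp]

definition word_class :: "'v dynkin \<Rightarrow> 'v list \<Rightarrow> 'v list set" where
  "word_class D us = coxeter_rel D `` {us}"

lemma coxeter_rel_in_lists:
  "(us, vs) \<in> coxeter_rel D \<Longrightarrow> us \<in> lists (vertices D) \<and> vs \<in> lists (vertices D)"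
  by (induction rule: coxeter_rel.induct) (auto simp: in_lists_conv_set)

lemma equiv_coxeter_rel: "equiv (lists (vertices D)) (coxeter_rel D)"
  by (rule equivI)
    (auto simp: refl_on_def sym_def trans_def dest: coxeter_rel_in_lists
      intro: coxeter_rel.refl coxeter_rel.sym coxeter_rel.trans)

lemma coxeter_rel_append:
  assumes "xs \<in> lists (vertices D)" "ys \<in> lists (vertices D)"
  shows "(us, vs) \<in> coxeter_rel D \<Longrightarrow> (xs @ us @ ys, xs @ vs @ ys) \<in> coxeter_rel D"
proof (induction rule: coxeter_rel.induct)
  case (relator us vs \<alpha> \<beta>)
  then show ?case
    using coxeter_rel.relator[of "xs @ us" D "vs @ ys" \<alpha> \<beta>] assms by simp
next
  case (refl us)
  then show ?case
    using coxeter_rel.refl[of "xs @ us @ ys" D] assms by simp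
qed (auto intro: coxeter_rel.sym coxeter_rel.trans)

lemma coxeter_rel_append2:
  assumes "(us, us') \<in> coxeter_rel D" "(vs, vs') \<in> coxeter_rel D"
  shows "(us @ vs, us' @ vs') \<in> coxeter_rel D"
proof (rule coxeter_rel.trans)
  show "(us @ vs, us' @ vs) \<in> coxeter_rel D"
    using coxeter_rel_append[of "[]" D vs us us'] assms coxeter_rel_in_lists[of vs] by simp
  show "(us' @ vs, us' @ vs') \<in> coxeter_rel D"
    using coxeter_rel_append[of us' D "[]" vs vs'] assms coxeter_rel_in_lists[of us] by simp
qed

lemma word_class_eq_iff:
  "us \<in> lists (vertices D) \<Longrightarrow> vs \<in> lists (vertices D) \<Longrightarrow>
    word_class D us = word_class D vs \<longleftrightarrow> (us, vs) \<in> coxeter_rel D"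
  unfolding word_class_def by (rule eq_equiv_class_iff[OF equiv_coxeter_rel])

lemma carrier_weyl_group: "carrier (weyl_group D) = word_class D ` lists (vertices D)"
  by (auto simp: weyl_group_def quotient_def word_class_def)

lemma one_weyl_group: "\<one>\<^bsub>weyl_group D\<^esub> = word_class D []"
  by (simp add: weyl_group_def word_class_def)

lemma word_class_in_carrier [simp]:
  "us \<in> lists (vertices D) \<Longrightarrow> word_class D us \<in> carrier (weyl_group D)"
  by (simp add: carrier_weyl_group)

text \<open>The product is a union over all representatives, and by congruence every pair
  contributes the same class.\<close>

lemma mult_word_class:
  assumes "us \<in> lists (vertices D)" "vs \<in> lists (vertices D)"
  shows "word_class D us \<otimes>\<^bsub>weyl_group D\<^esub> word_class D vs = word_class D (us @ vs)"
proof -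
  have "congruent2 (coxeter_rel D) (coxeter_rel D) (\<lambda>us vs. word_class D (us @ vs))"
    by (intro congruent2I')
      (auto simp: word_class_def intro!: equiv_class_eq[OF equiv_coxeter_rel] coxeter_rel_append2)
  from UN_equiv_class2[OF equiv_coxeter_rel equiv_coxeter_rel this assms]
  show ?thesis
    by (simp add: weyl_group_def word_class_def)
qed

text \<open>The relator of \<alpha> with itself, where the Coxeter matrix has the entry 1.\<close>

lemma word_class_cancel:
  assumes "us \<in> lists (vertices D)" "vs \<in> lists (vertices D)" "\<alpha> \<in> vertices D"
  shows "word_class D (us @ \<alpha> # \<alpha> # vs) = word_class D (us @ vs)"
  using coxeter_rel.relator[OF assms assms(3)] assms
  by (simp add: word_class_eq_iff coxeter_matrix_def)

text \<open>Generators are involutions, so the word cancels from the middle outwards; this provides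
  inverses.\<close>

lemma word_class_rev_mult:
  "us \<in> lists (vertices D) \<Longrightarrow> word_class D (rev us @ us) = word_class D []"
proof (induction us)
  case (Cons \<alpha> us)
  then show ?case
    using word_class_cancel[of "rev us" D us \<alpha>] by simp
qed simp

lemma group_weyl_group: "group (weyl_group D)"
proof (rule groupI)
  fix x assume "x \<in> carrier (weyl_group D)"
  then obtain us where us: "us \<in> lists (vertices D)" "x = word_class D us"
    by (auto simp: carrier_weyl_group)
  have "rev us \<in> lists (vertices D)"
    using us by (auto simp: in_lists_conv_set)
  then show "\<exists>y\<in>carrier (weyl_group D). y \<otimes>\<^bsub>weyl_group D\<^esub> x = \<one>\<^bsub>weyl_group D\<^esub>"
    using us word_class_rev_mult[of us D]
    by (intro bexI[of _ "word_class D (rev us)"]) (auto simp: mult_word_class one_weyl_group)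
next
  fix x y assume "x \<in> carrier (weyl_group D)" "y \<in> carrier (weyl_group D)"
  then obtain us vs where "us \<in> lists (vertices D)" "x = word_class D us"
    "vs \<in> lists (vertices D)" "y = word_class D vs"
    by (auto simp: carrier_weyl_group)
  then show "x \<otimes>\<^bsub>weyl_group D\<^esub> y \<in> carrier (weyl_group D)"
    by (simp add: mult_word_class)
qed (auto simp: carrier_weyl_group one_weyl_group mult_word_class)

text \<open>Every relator has even length, so parity is an invariant of the group element: the sign
  character.\<close>

lemma coxeter_rel_even_length:
  "(us, vs) \<in> coxeter_rel D \<Longrightarrow> even (length us) = even (length vs)"
  by (induction rule: coxeter_rel.induct) (auto simp: length_concat sum_list_replicate)

locale weyl =
  fixes D :: "'v dynkin"
begin

abbreviation W where "W \<equiv> weyl_group D"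
abbreviation words where "words \<equiv> lists (vertices D)"
abbreviation cls where "cls \<equiv> word_class D"
abbreviation len where "len \<equiv> coxeter_length D"
abbreviation srefl where "srefl \<equiv> simple_reflection D"

sublocale W: group W
  by (rule group_weyl_group)

lemma refl_eq: "srefl \<alpha> = cls [\<alpha>]"
  by (simp add: simple_reflection_def word_class_def)

lemma refl_carrier [simp]: "\<alpha> \<in> vertices D \<Longrightarrow> srefl \<alpha> \<in> carrier W"
  by (simp add: refl_eq)

lemma refl_mult_cls: "\<alpha> \<in> vertices D \<Longrightarrow> us \<in> words \<Longrightarrow> srefl \<alpha> \<otimes>\<^bsub>W\<^esub> cls us = cls (\<alpha> # us)"
  by (simp add: refl_eq mult_word_class)

lemma refl_refl: "\<alpha> \<in> vertices D \<Longrightarrow> srefl \<alpha> \<otimes>\<^bsub>W\<^esub> srefl \<alpha> = \<one>\<^bsub>W\<^esub>"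
  using word_class_cancel[of "[]" D "[]" \<alpha>] by (simp add: refl_eq mult_word_class one_weyl_group)

lemma refl_refl_mult:
  "\<alpha> \<in> vertices D \<Longrightarrow> x \<in> carrier W \<Longrightarrow> srefl \<alpha> \<otimes>\<^bsub>W\<^esub> (srefl \<alpha> \<otimes>\<^bsub>W\<^esub> x) = x"
  by (simp add: refl_refl flip: W.m_assoc)

lemma mult_refl_refl:
  "\<alpha> \<in> vertices D \<Longrightarrow> x \<in> carrier W \<Longrightarrow> x \<otimes>\<^bsub>W\<^esub> srefl \<alpha> \<otimes>\<^bsub>W\<^esub> srefl \<alpha> = x"
  by (simp add: refl_refl W.m_assoc)

lemma inv_refl: "\<alpha> \<in> vertices D \<Longrightarrow> inv\<^bsub>W\<^esub> (srefl \<alpha>) = srefl \<alpha>"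
  by (intro W.inv_equality refl_refl) auto

lemma inv_cls: "us \<in> words \<Longrightarrow> inv\<^bsub>W\<^esub> (cls us) = cls (rev us)"
  by (intro W.inv_equality)
    (auto simp: mult_word_class word_class_rev_mult one_weyl_group in_lists_conv_set)

lemma word_prod_eq: "us \<in> words \<Longrightarrow> word_prod D us = cls us"
  by (induction us) (auto simp: word_prod_def one_weyl_group refl_mult_cls)

section \<open>Coxeter length and its parity\<close>

lemma len_cls_le: "us \<in> words \<Longrightarrow> len (cls us) \<le> length us"
  unfolding coxeter_length_def by (rule Least_le) (auto simp: word_prod_eq)

lemma exists_reduced:
  assumes "w \<in> carrier W"
  obtains us where "us \<in> words" "cls us = w" "length us = len w"
proof -
  obtain us where "us \<in> words" "w = cls us"
    using assms by (auto simp: carrier_weyl_group)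
  then have "\<exists>k. \<exists>us\<in>words. length us = k \<and> word_prod D us = w"
    by (auto simp: word_prod_eq)
  then have "\<exists>us\<in>words. length us = len w \<and> word_prod D us = w"
    unfolding coxeter_length_def by (rule LeastI_ex)
  then show ?thesis
    using that by (auto simp: word_prod_eq)
qed

lemma reduced_word_iff: "reduced_word D us w \<longleftrightarrow> us \<in> words \<and> cls us = w \<and> length us = len w"
  by (auto simp: reduced_word_def word_prod_eq)

lemma reduced_word_some: "w \<in> carrier W \<Longrightarrow> reduced_word D (SOME us. reduced_word D us w) w"
  by (rule someI_ex) (metis exists_reduced reduced_word_iff)

lemma len_one: "len \<one>\<^bsub>W\<^esub> = 0"
  using len_cls_le[of "[]"] by (simp add: one_weyl_group)

lemma len_eq_0D: "w \<in> carrier W \<Longrightarrow> len w = 0 \<Longrightarrow> w = \<one>\<^bsub>W\<^esub>"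
  by (metis exists_reduced length_0_conv one_weyl_group)

lemma len_mult: "x \<in> carrier W \<Longrightarrow> y \<in> carrier W \<Longrightarrow> len (x \<otimes>\<^bsub>W\<^esub> y) \<le> len x + len y"
  by (metis append_in_lists_conv exists_reduced len_cls_le length_append mult_word_class)

lemma len_inv_le: "x \<in> carrier W \<Longrightarrow> len (inv\<^bsub>W\<^esub> x) \<le> len x"
proof -
  assume "x \<in> carrier W"
  then obtain us where us: "us \<in> words" "cls us = x" "length us = len x"
    by (rule exists_reduced)
  then have "rev us \<in> words" by (auto simp: in_lists_conv_set)
  from len_cls_le[OF this] us show ?thesis
    by (auto simp: inv_cls)
qed

lemma len_inv: "x \<in> carrier W \<Longrightarrow> len (inv\<^bsub>W\<^esub> x) = len x"
  using len_inv_le[of x] len_inv_le[of "inv\<^bsub>W\<^esub> x"] by simp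

lemma even_len_cls:
  assumes "us \<in> words"
  shows "even (len (cls us)) = even (length us)"
proof -
  obtain vs where vs: "vs \<in> words" "cls vs = cls us" "length vs = len (cls us)"
    using assms by (metis exists_reduced word_class_in_carrier)
  then have "(vs, us) \<in> coxeter_rel D"
    using assms by (simp add: word_class_eq_iff)
  from coxeter_rel_even_length[OF this] vs show ?thesis by simp
qed

lemma even_len_mult:
  assumes "x \<in> carrier W" "y \<in> carrier W"
  shows "even (len (x \<otimes>\<^bsub>W\<^esub> y)) = even (len x + len y)"
proof -
  obtain us vs where "us \<in> words" "x = cls us" "vs \<in> words" "y = cls vs"
    using assms by (auto simp: carrier_weyl_group)
  then show ?thesis
    using even_len_cls[of us] even_len_cls[of vs] even_len_cls[of "us @ vs"]
    by (simp add: mult_word_class)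
qed

lemma len_refl:
  assumes "\<alpha> \<in> vertices D"
  shows "len (srefl \<alpha>) = 1"
proof -
  have "len (cls [\<alpha>]) \<le> 1" "odd (len (cls [\<alpha>]))"
    using len_cls_le[of "[\<alpha>]"] even_len_cls[of "[\<alpha>]"] assms by auto
  then have "len (cls [\<alpha>]) = 1"
    by (cases "len (cls [\<alpha>])") auto
  then show ?thesis by (simp add: refl_eq)
qed

text \<open>
  Multiplication by a simple reflection changes the parity of the length, hence the length itself.
\<close>

lemma len_refl_mult:
  assumes "\<alpha> \<in> vertices D" "w \<in> carrier W"
  shows "len (srefl \<alpha> \<otimes>\<^bsub>W\<^esub> w) = len w + 1 \<or> len (srefl \<alpha> \<otimes>\<^bsub>W\<^esub> w) + 1 = len w"
proof -
  let ?x = "srefl \<alpha> \<otimes>\<^bsub>W\<^esub> w"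
  have "len ?x \<le> len w + 1" "even (len ?x) = odd (len w)"
    using len_mult[of "srefl \<alpha>" w] even_len_mult[of "srefl \<alpha>" w] assms by (simp_all add: len_refl)
  moreover have "len w \<le> len ?x + 1"
    using len_mult[of "srefl \<alpha>" ?x] assms by (simp add: len_refl refl_refl_mult)
  moreover have "len ?x \<noteq> len w"
    using \<open>even (len ?x) = odd (len w)\<close> by metis
  ultimately show ?thesis by linarith
qed

lemma len_mult_refl:
  assumes "\<alpha> \<in> vertices D" "w \<in> carrier W"
  shows "len (w \<otimes>\<^bsub>W\<^esub> srefl \<alpha>) = len w + 1 \<or> len (w \<otimes>\<^bsub>W\<^esub> srefl \<alpha>) + 1 = len w"
proof -
  have "len (w \<otimes>\<^bsub>W\<^esub> srefl \<alpha>) = len (srefl \<alpha> \<otimes>\<^bsub>W\<^esub> inv\<^bsub>W\<^esub> w)"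
    using len_inv[of "w \<otimes>\<^bsub>W\<^esub> srefl \<alpha>"] assms by (simp add: W.inv_mult_group inv_refl)
  then show ?thesis
    using len_refl_mult[of \<alpha> "inv\<^bsub>W\<^esub> w"] assms by (simp add: len_inv)
qed

section \<open>Bruhat comparison with a simple reflection\<close>

lemma bruhat_less_len: "bruhat_less D u w \<Longrightarrow> len u < len w"
  unfolding bruhat_less_def by (induction rule: trancl.induct) auto

text \<open>Bruhat comparison lowers the length, which a simple reflection changes by exactly one;
  conversely a single reflection witnesses the comparison.\<close>

lemma bruhat_less_refl_mult_iff:
  assumes "\<alpha> \<in> vertices D" "w \<in> carrier W"
  shows "bruhat_less D (srefl \<alpha> \<otimes>\<^bsub>W\<^esub> w) w \<longleftrightarrow> len (srefl \<alpha> \<otimes>\<^bsub>W\<^esub> w) + 1 = len w"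
proof
  assume "bruhat_less D (srefl \<alpha> \<otimes>\<^bsub>W\<^esub> w) w"
  then show "len (srefl \<alpha> \<otimes>\<^bsub>W\<^esub> w) + 1 = len w"
    using bruhat_less_len len_refl_mult[OF assms] by fastforce
next
  assume len: "len (srefl \<alpha> \<otimes>\<^bsub>W\<^esub> w) + 1 = len w"
  \<comment> \<open>The Bruhat order multiplies by reflections on the right, so the left factor
    \<open>srefl \<alpha>\<close> is undone by its conjugate under \<open>inv w\<close>.\<close>
  define t where "t = inv\<^bsub>W\<^esub> w \<otimes>\<^bsub>W\<^esub> srefl \<alpha> \<otimes>\<^bsub>W\<^esub> inv\<^bsub>W\<^esub> (inv\<^bsub>W\<^esub> w)"
  have t: "t \<in> reflections D"
    unfolding reflections_def t_def using assms by blast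
  have "srefl \<alpha> \<otimes>\<^bsub>W\<^esub> w \<otimes>\<^bsub>W\<^esub> t = srefl \<alpha> \<otimes>\<^bsub>W\<^esub> (w \<otimes>\<^bsub>W\<^esub> inv\<^bsub>W\<^esub> w) \<otimes>\<^bsub>W\<^esub> srefl \<alpha> \<otimes>\<^bsub>W\<^esub> w"
    using assms by (simp add: t_def W.m_assoc del: W.r_inv W.Units_r_inv)
  also have "\<dots> = w"
    using assms by (simp add: refl_refl)
  finally show "bruhat_less D (srefl \<alpha> \<otimes>\<^bsub>W\<^esub> w) w"
    unfolding bruhat_less_def using assms t len by (intro r_into_trancl) force
qed

lemma bruhat_less_mult_refl_iff:
  assumes "\<alpha> \<in> vertices D" "w \<in> carrier W"
  shows "bruhat_less D (w \<otimes>\<^bsub>W\<^esub> srefl \<alpha>) w \<longleftrightarrow> len (w \<otimes>\<^bsub>W\<^esub> srefl \<alpha>) + 1 = len w"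
proof
  assume "bruhat_less D (w \<otimes>\<^bsub>W\<^esub> srefl \<alpha>) w"
  then show "len (w \<otimes>\<^bsub>W\<^esub> srefl \<alpha>) + 1 = len w"
    using bruhat_less_len len_mult_refl[OF assms] by fastforce
next
  assume len: "len (w \<otimes>\<^bsub>W\<^esub> srefl \<alpha>) + 1 = len w"
  have "\<one>\<^bsub>W\<^esub> \<otimes>\<^bsub>W\<^esub> srefl \<alpha> \<otimes>\<^bsub>W\<^esub> inv\<^bsub>W\<^esub> \<one>\<^bsub>W\<^esub> \<in> reflections D"
    unfolding reflections_def using assms by blast
  then have "srefl \<alpha> \<in> reflections D"
    using assms by simp
  then show "bruhat_less D (w \<otimes>\<^bsub>W\<^esub> srefl \<alpha>) w"
    unfolding bruhat_less_def using assms len mult_refl_refl[OF assms]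
    by (intro r_into_trancl) force
qed


section \<open>Finiteness of the set of left descents\<close>

text \<open>
  The reflections crossed by the gallery of a word.  Modulo two, the number of times that each of
  them occurs depends only on the group element, because a relator crosses every reflection an even
  number of times.
\<close>

primrec crossed :: "'v list \<Rightarrow> 'v list set list" where
  "crossed [] = []"
| "crossed (\<alpha> # us) = srefl \<alpha> # map (\<lambda>t. srefl \<alpha> \<otimes>\<^bsub>W\<^esub> t \<otimes>\<^bsub>W\<^esub> srefl \<alpha>) (crossed us)"

lemma crossed_carrier: "us \<in> words \<Longrightarrow> set (crossed us) \<subseteq> carrier W"
  by (induction us) auto

text \<open>The gallery of \<open>vs\<close> now starts at \<open>cls us\<close>, which translates
  its walls, that is, conjugates their reflections.\<close>

lemma crossed_append:
  assumes "us \<in> words" "vs \<in> words"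
  shows "crossed (us @ vs) =
    crossed us @ map (\<lambda>t. cls us \<otimes>\<^bsub>W\<^esub> t \<otimes>\<^bsub>W\<^esub> inv\<^bsub>W\<^esub> (cls us)) (crossed vs)"
  using assms(1)
proof (induction us)
  case Nil
  have "map (\<lambda>t. cls [] \<otimes>\<^bsub>W\<^esub> t \<otimes>\<^bsub>W\<^esub> inv\<^bsub>W\<^esub> (cls [])) (crossed vs) = crossed vs"
    using crossed_carrier[OF assms(2)] by (intro map_idI) (auto simp flip: one_weyl_group)
  then show ?case by simp
next
  case (Cons \<alpha> us)
  have "srefl \<alpha> \<otimes>\<^bsub>W\<^esub> (cls us \<otimes>\<^bsub>W\<^esub> t \<otimes>\<^bsub>W\<^esub> inv\<^bsub>W\<^esub> (cls us)) \<otimes>\<^bsub>W\<^esub> srefl \<alpha> =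
      cls (\<alpha> # us) \<otimes>\<^bsub>W\<^esub> t \<otimes>\<^bsub>W\<^esub> inv\<^bsub>W\<^esub> (cls (\<alpha> # us))" if "t \<in> carrier W" for t
    using Cons that
    by (simp flip: refl_mult_cls add: W.inv_mult_group inv_refl W.m_assoc)
  then show ?case
    using Cons crossed_carrier[OF assms(2)] by (auto simp: subset_iff)
qed

lemma count_list_conj:
  assumes "g \<in> carrier W" "t \<in> carrier W" "set ts \<subseteq> carrier W"
  shows "count_list (map (\<lambda>t. g \<otimes>\<^bsub>W\<^esub> t \<otimes>\<^bsub>W\<^esub> inv\<^bsub>W\<^esub> g) ts) t =
    count_list ts (inv\<^bsub>W\<^esub> g \<otimes>\<^bsub>W\<^esub> t \<otimes>\<^bsub>W\<^esub> g)"
  using assms(3)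
proof (induction ts)
  case (Cons s ts)
  have "g \<otimes>\<^bsub>W\<^esub> s \<otimes>\<^bsub>W\<^esub> inv\<^bsub>W\<^esub> g = t \<longleftrightarrow> s = inv\<^bsub>W\<^esub> g \<otimes>\<^bsub>W\<^esub> t \<otimes>\<^bsub>W\<^esub> g"
  proof
    assume "g \<otimes>\<^bsub>W\<^esub> s \<otimes>\<^bsub>W\<^esub> inv\<^bsub>W\<^esub> g = t"
    then show "s = inv\<^bsub>W\<^esub> g \<otimes>\<^bsub>W\<^esub> t \<otimes>\<^bsub>W\<^esub> g"
      using Cons.prems assms by (auto simp: W.m_assoc W.mult_inv_cancel)
  next
    assume "s = inv\<^bsub>W\<^esub> g \<otimes>\<^bsub>W\<^esub> t \<otimes>\<^bsub>W\<^esub> g"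
    then show "g \<otimes>\<^bsub>W\<^esub> s \<otimes>\<^bsub>W\<^esub> inv\<^bsub>W\<^esub> g = t"
      using Cons.prems assms by (simp add: W.m_assoc W.mult_inv_cancel)
  qed
  then show ?case using Cons by auto
qed simp

text \<open>Prefixing \<alpha>, \<beta> conjugates the reflections crossed so far, which turns the
  exponent \<open>i\<close> into \<open>i + 2\<close>; the two new ones have exponents 0 and
  1.\<close>

lemma crossed_alternating:
  assumes "\<alpha> \<in> vertices D" "\<beta> \<in> vertices D"
  shows "crossed (concat (replicate n [\<alpha>, \<beta>])) =
    map (\<lambda>i. (srefl \<alpha> \<otimes>\<^bsub>W\<^esub> srefl \<beta>) [^]\<^bsub>W\<^esub> i \<otimes>\<^bsub>W\<^esub> srefl \<alpha>) [0..<2 * n]"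
proof (induction n)
  case (Suc n)
  let ?x = "srefl \<alpha> \<otimes>\<^bsub>W\<^esub> srefl \<beta>"
  have step: "srefl \<alpha> \<otimes>\<^bsub>W\<^esub> (srefl \<beta> \<otimes>\<^bsub>W\<^esub> (?x [^]\<^bsub>W\<^esub> i \<otimes>\<^bsub>W\<^esub> srefl \<alpha>) \<otimes>\<^bsub>W\<^esub> srefl \<beta>) \<otimes>\<^bsub>W\<^esub> srefl \<alpha> =
      ?x [^]\<^bsub>W\<^esub> (i + 2) \<otimes>\<^bsub>W\<^esub> srefl \<alpha>" for i :: nat
  proof -
    have "srefl \<alpha> \<otimes>\<^bsub>W\<^esub> (srefl \<beta> \<otimes>\<^bsub>W\<^esub> (?x [^]\<^bsub>W\<^esub> i \<otimes>\<^bsub>W\<^esub> srefl \<alpha>) \<otimes>\<^bsub>W\<^esub> srefl \<beta>) \<otimes>\<^bsub>W\<^esub> srefl \<alpha> =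
        ?x \<otimes>\<^bsub>W\<^esub> ?x [^]\<^bsub>W\<^esub> i \<otimes>\<^bsub>W\<^esub> ?x \<otimes>\<^bsub>W\<^esub> srefl \<alpha>"
      using assms by (simp add: W.m_assoc)
    also have "?x \<otimes>\<^bsub>W\<^esub> ?x [^]\<^bsub>W\<^esub> i \<otimes>\<^bsub>W\<^esub> ?x = ?x [^]\<^bsub>W\<^esub> (i + 2)"
      using assms W.nat_pow_Suc2[of ?x i] by simp
    finally show ?thesis .
  qed
  have "[0..<2 * Suc n] = 0 # 1 # map (\<lambda>i. i + 2) [0..<2 * n]"
    unfolding map_add_upt by (simp add: upt_conv_Cons numeral_2_eq_2 del: upt_Suc)
  then show ?case
    using assms by (simp add: Suc step comp_def del: upt_Suc)
qed simp

text \<open>The rotation has trivial power \<open>?m\<close>, so the list of \<open>2 * ?m\<close>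
  reflections consists of two equal halves.\<close>

lemma even_count_crossed_relator:
  assumes "\<alpha> \<in> vertices D" "\<beta> \<in> vertices D"
  shows "even (count_list (crossed (concat (replicate (coxeter_matrix D \<alpha> \<beta>) [\<alpha>, \<beta>]))) t)"
proof -
  let ?m = "coxeter_matrix D \<alpha> \<beta>" and ?x = "srefl \<alpha> \<otimes>\<^bsub>W\<^esub> srefl \<beta>"
  have pow: "cls (concat (replicate n [\<alpha>, \<beta>])) = ?x [^]\<^bsub>W\<^esub> n" for n
  proof (induction n)
    case (Suc n)
    have *: "concat (replicate n [\<alpha>, \<beta>]) \<in> words"
      using assms by (auto simp: in_lists_conv_set)
    show ?case
      using assms * Suc W.nat_pow_Suc2[of ?x n]
      by (simp flip: refl_mult_cls add: W.m_assoc)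
  qed (simp add: one_weyl_group)
  have "?x [^]\<^bsub>W\<^esub> ?m = \<one>\<^bsub>W\<^esub>"
    using coxeter_rel.relator[of "[]" D "[]" \<alpha> \<beta>] assms
      coxeter_rel_in_lists[of "concat (replicate ?m [\<alpha>, \<beta>])" "[]" D]
    by (simp flip: pow add: one_weyl_group word_class_eq_iff)
  then have period: "?x [^]\<^bsub>W\<^esub> (i + ?m) = ?x [^]\<^bsub>W\<^esub> i" for i
    using assms by (simp flip: W.nat_pow_mult)
  have "[0..<2 * ?m] = [0..<?m] @ map (\<lambda>i. i + ?m) [0..<?m]"
    using upt_add_eq_append[of 0 ?m ?m] by (simp add: map_add_upt mult_2)
  then show ?thesis
    using assms by (simp add: crossed_alternating comp_def period)
qed

lemma odd_count_crossed_cong: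
  "(us, vs) \<in> coxeter_rel D \<Longrightarrow> t \<in> carrier W \<Longrightarrow>
    odd (count_list (crossed us) t) = odd (count_list (crossed vs) t)"
proof (induction rule: coxeter_rel.induct)
  case (relator us vs \<alpha> \<beta>)
  let ?r = "concat (replicate (coxeter_matrix D \<alpha> \<beta>) [\<alpha>, \<beta>])"
  have r: "?r \<in> words"
    using relator by (auto simp: in_lists_conv_set)
  \<comment> \<open>As the relator is trivial in the group, the walls crossed after it are the same
    as without it.\<close>
  have cls: "cls (us @ ?r) = cls us"
    using coxeter_rel.relator[of us D "[]" \<alpha> \<beta>] relator r by (simp add: word_class_eq_iff)
  have "crossed (us @ ?r @ vs) =
      crossed us @ map (\<lambda>t. cls us \<otimes>\<^bsub>W\<^esub> t \<otimes>\<^bsub>W\<^esub> inv\<^bsub>W\<^esub> (cls us)) (crossed ?r) @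
      map (\<lambda>t. cls us \<otimes>\<^bsub>W\<^esub> t \<otimes>\<^bsub>W\<^esub> inv\<^bsub>W\<^esub> (cls us)) (crossed vs)"
    using crossed_append[of "us @ ?r" vs] crossed_append[of us ?r] relator r cls by simp
  moreover have "even (count_list (map (\<lambda>t. cls us \<otimes>\<^bsub>W\<^esub> t \<otimes>\<^bsub>W\<^esub> inv\<^bsub>W\<^esub> (cls us)) (crossed ?r)) t)"
    using relator crossed_carrier[OF r] even_count_crossed_relator by (simp add: count_list_conj)
  ultimately show ?case
    using relator by (simp add: crossed_append[of us vs])
qed auto

text \<open>Multiplication by the reflection crossed at a letter deletes that letter, a form of the
  exchange property.\<close>

lemma crossed_exchange:
  "us \<in> words \<Longrightarrow> t \<in> set (crossed us) \<Longrightarrow>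
    \<exists>vs\<in>words. length vs < length us \<and> cls vs = t \<otimes>\<^bsub>W\<^esub> cls us"
proof (induction us arbitrary: t)
  case (Cons \<alpha> us)
  then have \<alpha>: "\<alpha> \<in> vertices D" and us: "us \<in> words" by auto
  from Cons.prems consider "t = srefl \<alpha>"
    | s where "s \<in> set (crossed us)" "t = srefl \<alpha> \<otimes>\<^bsub>W\<^esub> s \<otimes>\<^bsub>W\<^esub> srefl \<alpha>" by auto
  then show ?case
  proof cases
    case 1
    then show ?thesis
      using \<alpha> us by (intro bexI[of _ us]) (simp_all flip: refl_mult_cls add: refl_refl_mult)
  next
    case 2
    then obtain vs where vs: "vs \<in> words" "length vs < length us" "cls vs = s \<otimes>\<^bsub>W\<^esub> cls us"
      using Cons.IH us by blast
    have "s \<in> carrier W" using 2 crossed_carrier us by auto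
    then have "cls (\<alpha> # vs) = t \<otimes>\<^bsub>W\<^esub> cls (\<alpha> # us)"
      using \<alpha> us vs 2
      by (simp flip: refl_mult_cls add: W.m_assoc refl_refl_mult)
    then show ?thesis
      using \<alpha> vs by (intro bexI[of _ "\<alpha> # vs"]) auto
  qed
qed simp

text \<open>The word \<open>\<alpha> # vs\<close>, with \<open>vs\<close> reduced, represents the
  same element and crosses \<open>srefl \<alpha>\<close> exactly once; by parity \<open>us\<close>
  must cross it too.\<close>

lemma left_descent_in_crossed:
  assumes us: "us \<in> words" and \<alpha>: "\<alpha> \<in> vertices D"
    and descent: "len (srefl \<alpha> \<otimes>\<^bsub>W\<^esub> cls us) < len (cls us)"
  shows "srefl \<alpha> \<in> set (crossed us)"
proof -
  let ?w = "cls us"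
  obtain vs where vs: "vs \<in> words" "cls vs = srefl \<alpha> \<otimes>\<^bsub>W\<^esub> ?w" "length vs = len (srefl \<alpha> \<otimes>\<^bsub>W\<^esub> ?w)"
    using \<alpha> us by (metis exists_reduced W.m_closed refl_carrier word_class_in_carrier)
  have cls: "cls (\<alpha> # vs) = ?w"
    using \<alpha> us vs by (simp flip: refl_mult_cls add: refl_refl_mult)
  \<comment> \<open>Otherwise exchange would give a word for \<open>?w\<close> shorter than
    \<open>vs\<close>, contradicting the descent.\<close>
  have "srefl \<alpha> \<notin> set (crossed vs)"
  proof
    assume "srefl \<alpha> \<in> set (crossed vs)"
    then obtain xs where "xs \<in> words" "length xs < length vs" "cls xs = srefl \<alpha> \<otimes>\<^bsub>W\<^esub> cls vs"
      using crossed_exchange vs by blast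
    then have "len ?w < length vs"
      using len_cls_le[of xs] vs \<alpha> us by (simp add: refl_refl_mult)
    then show False
      using vs descent by simp
  qed
  \<comment> \<open>Conjugation by \<open>srefl \<alpha>\<close> fixes
    \<open>srefl \<alpha>\<close>, so the tail contributes as many crossings as \<open>vs\<close>,
    namely none.\<close>
  then have "count_list (crossed (\<alpha> # vs)) (srefl \<alpha>) = 1"
    using count_list_conj[of "srefl \<alpha>" "srefl \<alpha>" "crossed vs"] \<alpha> crossed_carrier[of vs] vs
    by (simp add: inv_refl refl_refl)
  moreover have "(\<alpha> # vs, us) \<in> coxeter_rel D"
    using cls us vs \<alpha> by (simp add: word_class_eq_iff)
  ultimately have "odd (count_list (crossed us) (srefl \<alpha>))"
    using odd_count_crossed_cong[of "\<alpha> # vs" us "srefl \<alpha>"] \<alpha> by simp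
  then show ?thesis
    by (metis count_notin even_zero)
qed

text \<open>One word of \<open>w\<close> crosses all left descents, which bounds them even when the
  diagram has infinitely many vertices.\<close>

lemma finite_left_descents:
  assumes "w \<in> carrier W"
  shows "finite {srefl \<alpha> | \<alpha>. \<alpha> \<in> vertices D \<and> len (srefl \<alpha> \<otimes>\<^bsub>W\<^esub> w) < len w}"
proof -
  obtain us where us: "us \<in> words" "w = cls us"
    using assms by (auto simp: carrier_weyl_group)
  have "{srefl \<alpha> | \<alpha>. \<alpha> \<in> vertices D \<and> len (srefl \<alpha> \<otimes>\<^bsub>W\<^esub> w) < len w} \<subseteq> set (crossed us)"
    using left_descent_in_crossed us by auto
  then show ?thesis
    by (rule finite_subset) simp
qed

text \<open>The first letter of a reduced word of a nontrivial \<pi> is a left descent of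
  \<open>w\<close>; removing it leaves a factorization of a shorter element.\<close>

lemma finite_additive_factorizations:
  "w \<in> carrier W \<Longrightarrow> finite (additive_factorizations D w)"
proof (induction "len w" arbitrary: w rule: less_induct)
  case less
  let ?S = "{srefl \<alpha> | \<alpha>. \<alpha> \<in> vertices D \<and> len (srefl \<alpha> \<otimes>\<^bsub>W\<^esub> w) < len w}"
  have "additive_factorizations D w \<subseteq> {(\<one>\<^bsub>W\<^esub>, w)} \<union>
    (\<Union>r\<in>?S. (\<lambda>(\<pi>, \<rho>). (r \<otimes>\<^bsub>W\<^esub> \<pi>, \<rho>)) ` additive_factorizations D (r \<otimes>\<^bsub>W\<^esub> w))"
  proof
    fix p assume p: "p \<in> additive_factorizations D w"
    obtain \<pi> \<rho> where p_eq: "p = (\<pi>, \<rho>)" by (cases p)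
    have \<pi>: "\<pi> \<in> carrier W" and \<rho>: "\<rho> \<in> carrier W" and w: "w = \<pi> \<otimes>\<^bsub>W\<^esub> \<rho>"
      and len: "len w = len \<pi> + len \<rho>"
      using p p_eq by (auto simp: additive_factorizations_def)
    obtain us where us: "us \<in> words" "cls us = \<pi>" "length us = len \<pi>"
      using \<pi> by (rule exists_reduced)
    show "p \<in> {(\<one>\<^bsub>W\<^esub>, w)} \<union>
      (\<Union>r\<in>?S. (\<lambda>(\<pi>, \<rho>). (r \<otimes>\<^bsub>W\<^esub> \<pi>, \<rho>)) ` additive_factorizations D (r \<otimes>\<^bsub>W\<^esub> w))"
    proof (cases us)
      case Nil
      then show ?thesis
        using us w \<rho> p_eq by (auto simp flip: one_weyl_group)
    next
      case (Cons \<alpha> vs)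
      then have \<alpha>: "\<alpha> \<in> vertices D" and vs: "vs \<in> words" using us by auto
      have \<pi>_eq: "\<pi> = srefl \<alpha> \<otimes>\<^bsub>W\<^esub> cls vs"
        using Cons us \<alpha> vs by (simp add: refl_mult_cls)
      have rw: "srefl \<alpha> \<otimes>\<^bsub>W\<^esub> w = cls vs \<otimes>\<^bsub>W\<^esub> \<rho>"
        using w \<pi>_eq \<alpha> vs \<rho> by (simp add: W.m_assoc refl_refl_mult)
      \<comment> \<open>The upper bound through \<open>cls vs\<close> and \<rho> meets the lower
        bound \<open>len w - 1\<close>, so all these estimates are equalities and additivity is
        kept.\<close>
      have "len (cls vs) \<le> len \<pi> - 1" "len \<pi> > 0"
        using len_cls_le[OF vs] us Cons by auto
      moreover have "len (cls vs \<otimes>\<^bsub>W\<^esub> \<rho>) \<le> len (cls vs) + len \<rho>"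
        using len_mult vs \<rho> by simp
      moreover have "len w \<le> 1 + len (srefl \<alpha> \<otimes>\<^bsub>W\<^esub> w)"
        using len_refl_mult[OF \<alpha> less.prems] by auto
      ultimately have "len (srefl \<alpha> \<otimes>\<^bsub>W\<^esub> w) < len w"
        "len (srefl \<alpha> \<otimes>\<^bsub>W\<^esub> w) = len (cls vs) + len \<rho>"
        using len rw by auto
      then have "srefl \<alpha> \<in> ?S" "(cls vs, \<rho>) \<in> additive_factorizations D (srefl \<alpha> \<otimes>\<^bsub>W\<^esub> w)"
        using \<alpha> vs \<rho> rw by (auto simp: additive_factorizations_def)
      moreover have "p = (\<lambda>(\<pi>, \<rho>). (srefl \<alpha> \<otimes>\<^bsub>W\<^esub> \<pi>, \<rho>)) (cls vs, \<rho>)"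
        using p_eq \<pi>_eq by simp
      ultimately show ?thesis
        by (intro UnI2 UN_I image_eqI)
    qed
  qed
  moreover have "finite (additive_factorizations D (r \<otimes>\<^bsub>W\<^esub> w))" if "r \<in> ?S" for r
    using that less by auto
  ultimately show ?case
    using finite_left_descents[OF less.prems] by (auto intro: finite_subset)
qed

sublocale length_group W len
proof
  fix w assume "w \<in> carrier W"
  then show "finite (length_additive_pairs W len w)"
    using finite_additive_factorizations[of w]
    by (simp add: length_additive_pairs_def additive_factorizations_def)
qed (simp_all add: len_one len_eq_0D len_mult len_inv)


section \<open>Partial and martial operators\<close>

lemma H_eq: "H D = free_Abelian_group (carrier W)"
  by (simp add: H_def)

lemma Nil_algebra_eq: "Nil_algebra D = nil_ring W len"
  by (simp add: Nil_algebra_def nil_ring_def additive_factorizations_def length_additive_pairs_def)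

lemma martial_op_eq:
  assumes "\<alpha> \<in> vertices D"
  shows "martial_op D \<alpha> = lowering W len (srefl \<alpha>)"
  unfolding martial_op_def lowering_def H_eq
proof (intro restrict_ext frag_extend_eq)
  fix x w assume "x \<in> carrier (free_Abelian_group (carrier W))" "w \<in> Poly_Mapping.keys x"
  then show "(if bruhat_less D (srefl \<alpha> \<otimes>\<^bsub>W\<^esub> w) w then frag_of (srefl \<alpha> \<otimes>\<^bsub>W\<^esub> w) else 0) =
      (if len (srefl \<alpha> \<otimes>\<^bsub>W\<^esub> w) + len (srefl \<alpha>) = len w then frag_of (srefl \<alpha> \<otimes>\<^bsub>W\<^esub> w) else 0)"
    using assms bruhat_less_refl_mult_iff[of \<alpha> w] by (auto simp: len_refl)
qed

lemma partial_op_eq: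
  assumes "\<alpha> \<in> vertices D"
  shows "partial_op D \<alpha> = lowering (opposite_group W) len (srefl \<alpha>)"
  unfolding partial_op_def lowering_def H_eq opposite_group_simps
proof (intro restrict_ext frag_extend_eq)
  fix x w assume "x \<in> carrier (free_Abelian_group (carrier W))" "w \<in> Poly_Mapping.keys x"
  then show "(if bruhat_less D (w \<otimes>\<^bsub>W\<^esub> srefl \<alpha>) w then frag_of (w \<otimes>\<^bsub>W\<^esub> srefl \<alpha>) else 0) =
      (if len (w \<otimes>\<^bsub>W\<^esub> srefl \<alpha>) + len (srefl \<alpha>) = len w then frag_of (w \<otimes>\<^bsub>W\<^esub> srefl \<alpha>) else 0)"
    using assms bruhat_less_mult_refl_iff[of \<alpha> w] by (auto simp: len_refl)
qed

section \<open>Operators of reduced words and of group elements\<close>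

lemma reduced_Cons:
  assumes "\<alpha> # us \<in> words" "len (cls (\<alpha> # us)) = length (\<alpha> # us)"
  shows "len (cls us) = length us"
proof -
  have "len (cls (\<alpha> # us)) \<le> len (srefl \<alpha>) + len (cls us)"
    using len_mult[of "srefl \<alpha>" "cls us"] assms(1) by (simp add: refl_mult_cls)
  then show ?thesis
    using assms len_cls_le[of us] by (simp add: len_refl)
qed

text \<open>The right-hand side depends on the group element alone, which gives independence of the
  reduced word.\<close>

lemma martial_word_eq:
  "us \<in> words \<Longrightarrow> len (cls us) = length us \<Longrightarrow> martial_word D us = lowering W len (cls us)"
proof (induction us)
  case Nil
  then show ?case
    using lowering_one by (simp add: martial_word_def H_eq one_weyl_group)
next
  case (Cons \<alpha> us)
  have len: "len (cls us) = length us"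
    using reduced_Cons Cons.prems .
  have "martial_word D (\<alpha> # us) = martial_op D \<alpha> \<otimes>\<^bsub>End_ring (H D)\<^esub> martial_word D us"
    by (simp add: martial_word_def)
  also have "\<dots> = lowering W len (srefl \<alpha>) \<otimes>\<^bsub>End_free (carrier W)\<^esub> lowering W len (cls us)"
    using Cons len by (simp add: H_eq martial_op_eq)
  also have "\<dots> = lowering W len (srefl \<alpha> \<otimes>\<^bsub>W\<^esub> cls us)"
    using Cons.prems len by (intro lowering_mult) (simp_all add: refl_mult_cls len_refl)
  finally show ?case
    using Cons.prems by (simp add: refl_mult_cls)
qed

lemma partial_word_eq:
  "us \<in> words \<Longrightarrow> len (cls us) = length us \<Longrightarrow>
    partial_word D us = lowering (opposite_group W) len (cls us)"
proof (induction us)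
  interpret op: length_group "opposite_group W" len by (rule length_group_opposite_group)
  case Nil
  then show ?case
    using op.lowering_one by (simp add: partial_word_def H_eq one_weyl_group)
next
  interpret op: length_group "opposite_group W" len by (rule length_group_opposite_group)
  case (Cons \<alpha> us)
  have len: "len (cls us) = length us"
    using reduced_Cons Cons.prems .
  have "partial_word D (\<alpha> # us) = partial_word D us \<otimes>\<^bsub>End_ring (H D)\<^esub> partial_op D \<alpha>"
    by (simp add: partial_word_def)
  also have "\<dots> = lowering (opposite_group W) len (cls us) \<otimes>\<^bsub>End_free (carrier W)\<^esub>
      lowering (opposite_group W) len (srefl \<alpha>)"
    using Cons len by (simp add: H_eq partial_op_eq)
  \<comment> \<open>The reversed composition in \<open>partial_word\<close> is compensated by the
    reversed multiplication of the opposite group.\<close>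
  also have "\<dots> = lowering (opposite_group W) len (srefl \<alpha> \<otimes>\<^bsub>W\<^esub> cls us)"
    using op.lowering_mult[of "cls us" "srefl \<alpha>"] Cons.prems len
    by (simp add: refl_mult_cls len_refl)
  finally show ?case
    using Cons.prems by (simp add: refl_mult_cls)
qed

lemma martial_eq: "w \<in> carrier W \<Longrightarrow> martial D w = lowering W len w"
  unfolding martial_def using reduced_word_some[of w] by (auto simp: reduced_word_iff martial_word_eq)

lemma partial_eq: "w \<in> carrier W \<Longrightarrow> partial D w = lowering (opposite_group W) len w"
  unfolding partial_def using reduced_word_some[of w] by (auto simp: reduced_word_iff partial_word_eq)

lemma martial_action_eq: "martial_action D = nil_action W len"
  unfolding martial_action_def nil_action_def H_eq
  by (intro ext restrict_ext sum.cong) (auto simp: martial_eq)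

lemma partial_action_eq: "partial_action D = nil_action (opposite_group W) len"
  unfolding partial_action_def nil_action_def H_eq opposite_group_simps
  by (intro ext restrict_ext sum.cong) (auto simp: partial_eq)

text \<open>Composition extends the hypothesis from the generators to words, and by
  \<open>partial_word_eq\<close> to all right lowering operators.\<close>

lemma commute_partial_word:
  assumes C: "C \<in> carrier (End_ring (H D))"
    and comm: "\<And>\<alpha>. \<alpha> \<in> vertices D \<Longrightarrow>
      C \<otimes>\<^bsub>End_ring (H D)\<^esub> partial_op D \<alpha> = partial_op D \<alpha> \<otimes>\<^bsub>End_ring (H D)\<^esub> C"
  shows "us \<in> words \<Longrightarrow> partial_word D us \<in> carrier (End_ring (H D)) \<and>
    C \<otimes>\<^bsub>End_ring (H D)\<^esub> partial_word D us = partial_word D us \<otimes>\<^bsub>End_ring (H D)\<^esub> C"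
proof (induction us)
  interpret E: ring "End_ring (H D)" unfolding H_eq by (rule ring_End_free)
  case Nil
  then show ?case using C by (simp add: partial_word_def)
next
  interpret E: ring "End_ring (H D)" unfolding H_eq by (rule ring_End_free)
  interpret op: length_group "opposite_group W" len by (rule length_group_opposite_group)
  case (Cons \<alpha> us)
  then have \<alpha>: "\<alpha> \<in> vertices D" and IH: "partial_word D us \<in> carrier (End_ring (H D))"
    "C \<otimes>\<^bsub>End_ring (H D)\<^esub> partial_word D us = partial_word D us \<otimes>\<^bsub>End_ring (H D)\<^esub> C"
    by auto
  have p: "partial_op D \<alpha> \<in> carrier (End_ring (H D))"
    using op.lowering_End[of "srefl \<alpha>"] \<alpha> by (simp add: partial_op_eq H_eq)
  have eq: "partial_word D (\<alpha> # us) = partial_word D us \<otimes>\<^bsub>End_ring (H D)\<^esub> partial_op D \<alpha>"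
    by (simp add: partial_word_def)
  show ?case
    unfolding eq using IH p C comm[OF \<alpha>] by (metis E.m_assoc E.m_closed)
qed

lemma commute_partial_op_eq_martial_action:
  assumes C: "C \<in> carrier (End_ring (H D))"
    and comm: "\<And>\<alpha>. \<alpha> \<in> vertices D \<Longrightarrow>
      C \<otimes>\<^bsub>End_ring (H D)\<^esub> partial_op D \<alpha> = partial_op D \<alpha> \<otimes>\<^bsub>End_ring (H D)\<^esub> C"
  shows "\<exists>!c. c \<in> carrier (Nil_algebra D) \<and> C = martial_action D c"
proof (rule ex_ex1I)
  let ?c = "\<lambda>\<pi>\<in>carrier W. Poly_Mapping.lookup (C (frag_of (inv\<^bsub>W\<^esub> \<pi>))) \<one>\<^bsub>W\<^esub>"
  have "C = nil_action W len ?c"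
  proof (rule commuting_eq_nil_action)
    fix \<rho> assume "\<rho> \<in> carrier W"
    \<comment> \<open>A reduced word is needed here: only for such words is
      \<open>partial_word\<close> identified with the lowering operator.\<close>
    then obtain us where "us \<in> words" "cls us = \<rho>" "length us = len \<rho>"
      by (rule exists_reduced)
    then show "C \<otimes>\<^bsub>End_free (carrier W)\<^esub> lowering (opposite_group W) len \<rho> =
        lowering (opposite_group W) len \<rho> \<otimes>\<^bsub>End_free (carrier W)\<^esub> C"
      using commute_partial_word[OF C comm, of us] partial_word_eq[of us] by (simp add: H_eq)
  qed (use C in \<open>simp add: H_eq\<close>)
  then show "\<exists>c. c \<in> carrier (Nil_algebra D) \<and> C = martial_action D c"
    by (intro exI[of _ ?c]) (simp add: Nil_algebra_eq nil_ring_def martial_action_eq)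
next
  fix c c' assume "c \<in> carrier (Nil_algebra D) \<and> C = martial_action D c"
    "c' \<in> carrier (Nil_algebra D) \<and> C = martial_action D c'"
  then show "c = c'"
    using nil_action_inj[of c c'] by (simp add: Nil_algebra_eq martial_action_eq)
qed

end

theorem theorem2:
  fixes D :: "'v dynkin"
  assumes "dynkin_diagram D"
  shows
    \<comment> \<open>well-definedness of the product of \<open>Nil(D)\<close>, of \<open>M\<^sub>\<pi>\<close>, \<open>\<partial>\<^sub>\<pi>\<close> and of infinite sums of them\<close>
    "(\<forall>w\<in>carrier (weyl_group D). finite (additive_factorizations D w)) \<and>
     (\<forall>\<pi>\<in>carrier (weyl_group D). \<forall>as. reduced_word D as \<pi> \<longrightarrow>
        martial_word D as = martial D \<pi> \<and> partial_word D as = partial D \<pi>) \<and>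
     (\<forall>x\<in>carrier (H D).
        finite {\<pi> \<in> carrier (weyl_group D). martial D \<pi> x \<noteq> 0} \<and>
        finite {\<pi> \<in> carrier (weyl_group D). partial D \<pi> x \<noteq> 0}) \<and>
     \<comment> \<open>(1) the two actions, and that they commute\<close>
     ring_hom_ring (Nil_algebra D) (End_ring (H D)) (martial_action D) \<and>
     ring_hom_ring (opposite_ring (Nil_algebra D)) (End_ring (H D)) (partial_action D) \<and>
     (\<forall>a\<in>carrier (Nil_algebra D). \<forall>b\<in>carrier (Nil_algebra D).
        martial_action D a \<otimes>\<^bsub>End_ring (H D)\<^esub> partial_action D b =
        partial_action D b \<otimes>\<^bsub>End_ring (H D)\<^esub> martial_action D a) \<and>
     \<comment> \<open>(2) operators commuting with all \<open>\<partial>\<^sub>\<alpha>\<close>\<close>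
     (\<forall>C\<in>carrier (End_ring (H D)).
        (\<forall>\<alpha>\<in>vertices D.
           C \<otimes>\<^bsub>End_ring (H D)\<^esub> partial_op D \<alpha> = partial_op D \<alpha> \<otimes>\<^bsub>End_ring (H D)\<^esub> C) \<longrightarrow>
        (\<exists>!c. c \<in> carrier (Nil_algebra D) \<and> C = martial_action D c)) \<and>
     \<comment> \<open>each is the commutant of the other\<close>
     commutant (End_ring (H D)) (partial_action D ` carrier (Nil_algebra D)) =
       martial_action D ` carrier (Nil_algebra D) \<and>
     commutant (End_ring (H D)) (martial_action D ` carrier (Nil_algebra D)) =
       partial_action D ` carrier (Nil_algebra D)"
proof -
  interpret weyl D .
  interpret op: length_group "opposite_group W" len by (rule length_group_opposite_group)
  have opposite: "opposite_ring (Nil_algebra D) = nil_ring (opposite_group W) len"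
    by (simp add: Nil_algebra_eq nil_ring_opposite_group)
  have carrier: "carrier (Nil_algebra D) = carrier (nil_ring (opposite_group W) len)"
    by (simp add: Nil_algebra_eq nil_ring_def)
  show ?thesis
  proof (intro conjI ballI allI impI)
    fix w assume "w \<in> carrier W"
    then show "finite (additive_factorizations D w)"
      by (rule finite_additive_factorizations)
  next
    fix \<pi> us assume "\<pi> \<in> carrier W" "reduced_word D us \<pi>"
    then show "martial_word D us = martial D \<pi>" "partial_word D us = partial D \<pi>"
      by (auto simp: reduced_word_iff martial_eq partial_eq martial_word_eq partial_word_eq)
  next
    fix x assume "x \<in> carrier (H D)"
    then have x: "Poly_Mapping.keys x \<subseteq> carrier W"
      by (simp add: H_eq)
    show "finite {\<pi> \<in> carrier W. martial D \<pi> x \<noteq> 0}" "finite {\<pi> \<in> carrier W. partial D \<pi> x \<noteq> 0}"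
      using finite_lowering_nonzero[OF x] op.finite_lowering_nonzero[of x] x
      by (simp_all add: martial_eq partial_eq cong: conj_cong)
  next
    show "ring_hom_ring (Nil_algebra D) (End_ring (H D)) (martial_action D)"
      unfolding Nil_algebra_eq H_eq martial_action_eq by (rule ring_hom_nil_action)
    show "ring_hom_ring (opposite_ring (Nil_algebra D)) (End_ring (H D)) (partial_action D)"
      unfolding opposite H_eq partial_action_eq using op.ring_hom_nil_action by simp
  next
    fix a b
    show "martial_action D a \<otimes>\<^bsub>End_ring (H D)\<^esub> partial_action D b =
        partial_action D b \<otimes>\<^bsub>End_ring (H D)\<^esub> martial_action D a"
      unfolding H_eq martial_action_eq partial_action_eq by (rule nil_action_opposite_commute)
  next
    fix C assume "C \<in> carrier (End_ring (H D))"
      "\<forall>\<alpha>\<in>vertices D.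
        C \<otimes>\<^bsub>End_ring (H D)\<^esub> partial_op D \<alpha> = partial_op D \<alpha> \<otimes>\<^bsub>End_ring (H D)\<^esub> C"
    then show "\<exists>!c. c \<in> carrier (Nil_algebra D) \<and> C = martial_action D c"
      by (intro commute_partial_op_eq_martial_action) auto
  next
    show "commutant (End_ring (H D)) (partial_action D ` carrier (Nil_algebra D)) =
        martial_action D ` carrier (Nil_algebra D)"
      using commutant_nil_action_opposite
      by (simp add: H_eq martial_action_eq partial_action_eq carrier flip: Nil_algebra_eq)
    \<comment> \<open>The same commutant lemma for the opposite group, whose own opposite is
      \<open>W\<close> again.\<close>
    show "commutant (End_ring (H D)) (martial_action D ` carrier (Nil_algebra D)) =
        partial_action D ` carrier (Nil_algebra D)"
      using op.commutant_nil_action_opposite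
      by (simp add: H_eq martial_action_eq partial_action_eq carrier flip: Nil_algebra_eq)
  qed
qed

end
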